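(* Let $0<c<1$ be fixed. For every integer $n>2$ let $\mathbf X=(X_1,\dots,X_n)'$ and $\mathbf Y=(Y_1,\dots,Y_n)'$ be two independent random vectors such that $\mathbf X$ has an $n$-variate spherical distribution with $P(\mathbf X=(0,\dots,0)')=0$ and $\mathbf Y$ has any distribution with $P(\mathbf Y\in\{k(1,\dots,1)' : k\in\mathbb R\})=0$. Let $r_n$ be the empirical Pearson correlation coefficient of $(\mathbf X,\mathbf Y)$. Then, as $n\to\infty$, $$P(r_n\ge c)=\frac{\exp\Big(-nL^*(c)-\frac14\log(1+4\lambda_c^2)+\frac32\log\frac{1+\sqrt{1+4\lambda_c^2}}{2}\Big)}{\lambda_c\,\sigma_c\sqrt{2\pi n}}\,(1+o(1)),$$ where $\lambda_c$ is the unique solution of $L'(\lambda)=c$, i.e. $\lambda_c=\frac{c}{1-c^2}$; $\sigma_c>0$ is given by $\sigma_c^2=L''(\lambda_c)=\frac{(1-c^2)^2}{1+c^2}$; and $L^*(y)=-\frac12\log(1-y^2)$ for $-1<y<1$.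
   Context: The empirical Pearson correlation coefficient is $$r_n=\frac{\sum_{i=1}^n(X_i-\bar X_n)(Y_i-\bar Y_n)}{\sqrt{\sum_{i=1}^n(X_i-\bar X_n)^2\,\sum_{i=1}^n(Y_i-\bar Y_n)^2}},\qquad \bar X_n=\frac1n\sum_{k=1}^nX_k,\quad \bar Y_n=\frac1n\sum_{k=1}^nY_k .$$ A random vector in $\mathbb R^n$ has a spherical distribution if its law is invariant under all orthogonal transformations of $\mathbb R^n$. The function $L$ is $L(\lambda)=h(r_0(\lambda))$, $\lambda\in\mathbb R$, where $h(r)=\lambda r+\frac12\log(1-r^2)$ (for the given $\lambda$) and $r_0(\lambda)=\frac{-1+\sqrt{1+4\lambda^2}}{2\lambda}$ (with $r_0(0)=0$) is the unique root in $]-1,1[$ of $h'(r)=0$. *)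

theory Defs
  imports "HOL-Probability.Probability" "HOL-Library.Landau_Symbols"
begin

text \<open>
  The dimension varies along the sequence, so a vector of \<open>\<real>\<^sup>n\<close> is an extensional function on
  \<open>{1..n}\<close>, and \<open>\<real>\<^sup>n\<close> with its Borel sets is the product space below.
\<close>

abbreviation euclid :: "nat \<Rightarrow> (nat \<Rightarrow> real) measure" where
  "euclid n \<equiv> Pi\<^sub>M {1..n} (\<lambda>_. borel)"

definition orthogonal_mat_n :: "nat \<Rightarrow> (nat \<Rightarrow> nat \<Rightarrow> real) \<Rightarrow> bool" where
  "orthogonal_mat_n n Q \<longleftrightarrow>
     (\<forall>j\<in>{1..n}. \<forall>k\<in>{1..n}. (\<Sum>i=1..n. Q i j * Q i k) = (if j = k then 1 else 0))"

definition mat_apply :: "nat \<Rightarrow> (nat \<Rightarrow> nat \<Rightarrow> real) \<Rightarrow> (nat \<Rightarrow> real) \<Rightarrow> nat \<Rightarrow> real" where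
  "mat_apply n Q x = (\<lambda>i\<in>{1..n}. \<Sum>j=1..n. Q i j * x j)"

definition spherical :: "nat \<Rightarrow> (nat \<Rightarrow> real) measure \<Rightarrow> bool" where
  "spherical n P \<longleftrightarrow> (\<forall>Q. orthogonal_mat_n n Q \<longrightarrow> distr P (euclid n) (mat_apply n Q) = P)"

definition emp_mean :: "nat \<Rightarrow> (nat \<Rightarrow> real) \<Rightarrow> real" where
  "emp_mean n x = (1 / real n) * (\<Sum>k=1..n. x k)"

text \<open>
  If one of the vectors is constant the denominator vanishes and the value is \<open>0\<close>.
\<close>

definition pearson :: "nat \<Rightarrow> (nat \<Rightarrow> real) \<Rightarrow> (nat \<Rightarrow> real) \<Rightarrow> real" where
  "pearson n x y =
     (\<Sum>i=1..n. (x i - emp_mean n x) * (y i - emp_mean n y)) /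
     sqrt ((\<Sum>i=1..n. (x i - emp_mean n x)\<^sup>2) * (\<Sum>i=1..n. (y i - emp_mean n y)\<^sup>2))"

definition h_fun :: "real \<Rightarrow> real \<Rightarrow> real" where
  "h_fun l r = l * r + 1/2 * ln (1 - r\<^sup>2)"

definition r0 :: "real \<Rightarrow> real" where
  "r0 l = (if l = 0 then 0 else (- 1 + sqrt (1 + 4 * l\<^sup>2)) / (2 * l))"

definition L_fun :: "real \<Rightarrow> real" where
  "L_fun l = h_fun l (r0 l)"

definition L_star :: "real \<Rightarrow> real" where
  "L_star y = - (1/2) * ln (1 - y\<^sup>2)"

definition lambda_c :: "real \<Rightarrow> real" where
  "lambda_c c = (THE l. (L_fun has_real_derivative c) (at l))"

definition sigma_c :: "real \<Rightarrow> real" where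
  "sigma_c c = sqrt (deriv (deriv L_fun) (lambda_c c))"

lemma h_fun_deriv:
  assumes "-1 < r" "r < 1"
  shows "(h_fun l has_real_derivative (l - r / (1 - r\<^sup>2))) (at r)"
proof -
  have "r\<^sup>2 < 1" using assms by (simp add: abs_square_less_1 abs_less_iff)
  then show ?thesis
    unfolding h_fun_def [abs_def]
    by (auto intro!: derivative_eq_intros simp: field_simps)
qed

lemma r0_unique_root:
  "-1 < r \<and> r < 1 \<and> (h_fun l has_real_derivative 0) (at r) \<longleftrightarrow> r = r0 l"
proof -
  define s where "s = sqrt (1 + 4 * l\<^sup>2)"
  have s2: "s * s = 1 + 4 * l * l" and s1: "s \<ge> 1"
    by (auto simp: s_def power2_eq_square)
  have r0s: "r0 l = 2 * l / (1 + s)"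
  proof (cases "l = 0")
    case False
    have "(- 1 + s) * (1 + s) = 2 * l * (2 * l)" using s2 by (simp add: algebra_simps)
    then have "(- 1 + s) / (2 * l) = 2 * l / (1 + s)"
      using False s1 by (simp add: frac_eq_eq)
    then show ?thesis using False by (simp add: r0_def s_def)
  qed (simp add: r0_def)
  have lt: "\<bar>2 * l\<bar> < 1 + s"
  proof -
    have "\<bar>2 * l\<bar> < s"
      unfolding s_def by (rule real_less_rsqrt) (simp add: power_mult_distrib)
    then show ?thesis by simp
  qed
  have b: "-1 < r0 l" "r0 l < 1" using lt s1 by (auto simp: r0s field_simps abs_less_iff)
  have root: "r0 l = l * (1 - (r0 l)\<^sup>2)"
  proof -
    have q: "r0 l * (1 + s) = 2 * l" using s1 by (simp add: r0s)
    have "(1 + s) * (1 + s) * (r0 l - l * (1 - (r0 l)\<^sup>2))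
        = (1 + s) * (r0 l * (1 + s)) - l * ((1 + s) * (1 + s) - (r0 l * (1 + s)) * (r0 l * (1 + s)))"
      by (simp add: algebra_simps power2_eq_square)
    also have "\<dots> = l * (1 + 4 * l * l - s * s)"
      unfolding q by (simp add: algebra_simps)
    also have "\<dots> = 0" using s2 by simp
    finally show ?thesis using s1 by simp
  qed
  have eq: "(h_fun l has_real_derivative 0) (at r) \<longleftrightarrow> r = l * (1 - r\<^sup>2)" if "-1 < r" "r < 1" for r
  proof -
    have "r\<^sup>2 < 1" using that by (simp add: abs_square_less_1 abs_less_iff)
    moreover have "(h_fun l has_real_derivative 0) (at r) \<longleftrightarrow> l - r / (1 - r\<^sup>2) = 0"
      using h_fun_deriv[OF that, of l] DERIV_unique by metis
    ultimately show ?thesis by (auto simp: field_simps)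
  qed
  have uniq: "r = r0 l" if "-1 < r" "r < 1" "r = l * (1 - r\<^sup>2)" for r
  proof -
    let ?q = "r0 l"
    have "r * (1 - ?q\<^sup>2) = ?q * (1 - r\<^sup>2)" using that(3) root by algebra
    then have "(r - ?q) * (1 + r * ?q) = 0" by (simp add: algebra_simps power2_eq_square)
    moreover have "\<bar>r * ?q\<bar> < 1"
      using that(1,2) b by (simp add: abs_mult abs_less_iff mult_strict_mono'[of "\<bar>r\<bar>" 1 "\<bar>?q\<bar>" 1, simplified])
    ultimately show ?thesis by auto
  qed
  show ?thesis using b root eq uniq by metis
qed

end

theory Submission
  imports Defs "HOL-Real_Asymp.Real_Asymp"
begin

text \<open>
  For a fixed non-constant \<open>y\<close> the coefficient is at least \<open>c\<close> iff \<open>x\<close>, projected orthogonally to the unit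
  vector \<open>d\<close> proportional to \<open>(1,\<dots>,1)\<close>, makes an angle of cosine at least \<open>c\<close> with a unit vector
  \<open>u\<close> orthogonal to \<open>d\<close>. Sphericity makes the probability independent of the orthonormal pair
  \<open>(u, d)\<close>; averaging over \<open>u\<close> and exchanging the integrals identifies it with the relative volume of
  a circular cone in the unit ball of dimension \<open>n - 1\<close>. With \<open>k = n - 2\<close>, and \<open>\<omega>\<close> the volumes of
  unit balls, this is
  \<open>\<omega>\<^sub>k / \<omega>\<^sub>k\<^sub>+\<^sub>1 \<cdot> (c sqrt (1 - c\<^sup>2) ^ k / (k + 1) + I)\<close>, where \<open>I\<close> is the integral of
  \<open>sqrt (1 - t\<^sup>2) ^ k\<close> over \<open>[c, 1]\<close>. Log-convexity of Gamma gives \<open>\<omega>\<^sub>k / \<omega>\<^sub>k\<^sub>+\<^sub>1 \<sim> sqrt (k / (2 \<pi>))\<close>, and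
  \<open>I\<close> is asymptotic to \<open>sqrt (1 - c\<^sup>2) ^ (k + 2) / (c k)\<close>.
\<close>

section \<open>The function L and its derivatives\<close>

lemma one_plus_sqrt:
  fixes l :: real
  shows "(sqrt (1 + 4 * l\<^sup>2))\<^sup>2 = 1 + 4 * l\<^sup>2" "sqrt (1 + 4 * l\<^sup>2) \<ge> 1"
proof -
  have "1 + 4 * l\<^sup>2 \<ge> 1" by simp
  then show "(sqrt (1 + 4 * l\<^sup>2))\<^sup>2 = 1 + 4 * l\<^sup>2" "sqrt (1 + 4 * l\<^sup>2) \<ge> 1"
    by (auto intro: real_sqrt_pow2)
qed

text \<open>Multiplying by the conjugate \<open>1 + sqrt (1 + 4 * l\<^sup>2)\<close> removes the
  division by \<open>l\<close>. The new denominator is at least 2, so \<open>l = 0\<close> is no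
  longer a special case and \<open>r0\<close> can be differentiated everywhere by one quotient
  rule.\<close>

lemma r0_eq: "r0 l = 2 * l / (1 + sqrt (1 + 4 * l\<^sup>2))"
proof (cases "l = 0")
  case False
  define s where "s = sqrt (1 + 4 * l\<^sup>2)"
  have s: "s\<^sup>2 = 1 + 4 * l\<^sup>2" "s \<ge> 1" using one_plus_sqrt[of l] by (auto simp: s_def)
  have "(s - 1) * (1 + s) = (2 * l) * (2 * l)"
    using s(1) by (simp add: algebra_simps power2_eq_square)
  then have "(s - 1) / (2 * l) = 2 * l / (1 + s)"
    using False s(2) by (simp add: frac_eq_eq)
  then show ?thesis
    using False by (simp add: r0_def s_def)
qed (simp add: r0_def)

lemma one_minus_r0_squared: "1 - (r0 l)\<^sup>2 = 2 / (1 + sqrt (1 + 4 * l\<^sup>2))"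
proof -
  define s where "s = sqrt (1 + 4 * l\<^sup>2)"
  have s: "s\<^sup>2 = 1 + 4 * l\<^sup>2" "s \<ge> 1" using one_plus_sqrt[of l] by (auto simp: s_def)
  have "(r0 l)\<^sup>2 = (s\<^sup>2 - 1) / (1 + s)\<^sup>2"
    by (simp add: r0_eq power_divide s(1) s_def[symmetric])
  also have "s\<^sup>2 - 1 = (s - 1) * (1 + s)" by (simp add: power2_eq_square algebra_simps)
  also have "\<dots> / (1 + s)\<^sup>2 = (s - 1) / (1 + s)" by (simp add: power2_eq_square)
  finally have "1 - (r0 l)\<^sup>2 = 1 - (s - 1) / (1 + s)" by simp
  also have "\<dots> = 2 / (1 + s)" using s(2) by (simp add: field_simps)
  finally show ?thesis by (simp add: s_def)
qed

lemma L_fun_eq: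
  "L_fun l = (sqrt (1 + 4 * l\<^sup>2) - 1) / 2 + 1/2 * ln (2 / (1 + sqrt (1 + 4 * l\<^sup>2)))"
proof -
  have "l * r0 l = (sqrt (1 + 4 * l\<^sup>2) - 1) / 2"
    by (simp add: r0_def)
  then show ?thesis by (simp add: L_fun_def h_fun_def one_minus_r0_squared)
qed

lemma has_real_derivative_sqrt_one_plus:
  "((\<lambda>l. sqrt (1 + 4 * l\<^sup>2)) has_real_derivative 4 * l / sqrt (1 + 4 * l\<^sup>2)) (at l)"
proof -
  have "1 + 4 * l\<^sup>2 > 0" by (simp add: add_pos_nonneg)
  then show ?thesis by (auto intro!: derivative_eq_intros simp: field_simps)
qed

text \<open>The envelope principle explains the value: \<open>r0 l\<close> is a critical point of
  \<open>h_fun l\<close>, so only the explicit dependence of \<open>h_fun l r\<close> on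
  \<open>l\<close> contributes, and its derivative is \<open>r\<close>. The proof differentiates the
  closed form \<open>L_fun_eq\<close> directly.\<close>

lemma L_fun_has_derivative: "(L_fun has_real_derivative r0 l) (at l)"
proof -
  define S where "S = (\<lambda>l::real. sqrt (1 + 4 * l\<^sup>2))"
  have S: "S l \<ge> 1" for l using one_plus_sqrt(2)[of l] by (simp add: S_def)
  have pos: "0 < 1 + S l" for l using S[of l] by linarith
  have dS: "(S has_real_derivative 4 * l / S l) (at l)"
    unfolding S_def by (rule has_real_derivative_sqrt_one_plus)
  have "((\<lambda>l. (S l - 1) / 2 + 1/2 * (ln 2 - ln (1 + S l))) has_real_derivative
      (4 * l / S l) / 2 - 1/2 * (1 / (1 + S l) * (4 * l / S l))) (at l)"
    using pos by (auto intro!: derivative_eq_intros dS)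
  also have "(4 * l / S l) / 2 - 1/2 * (1 / (1 + S l) * (4 * l / S l)) = 2 * l / (1 + S l)"
    using S[of l] by (simp add: divide_simps) (simp add: algebra_simps)
  also have "(\<lambda>l. (S l - 1) / 2 + 1/2 * (ln 2 - ln (1 + S l))) = L_fun"
  proof
    fix l
    show "(S l - 1) / 2 + 1/2 * (ln 2 - ln (1 + S l)) = L_fun l"
      using pos[of l] by (simp add: L_fun_eq S_def ln_div)
  qed
  finally show ?thesis by (simp add: r0_eq S_def)
qed

lemma r0_has_derivative:
  defines "S \<equiv> \<lambda>l::real. sqrt (1 + 4 * l\<^sup>2)"
  shows "(r0 has_real_derivative 2 / (S l * (1 + S l))) (at l)"
proof -
  have S: "(S l)\<^sup>2 = 1 + 4 * l\<^sup>2" "S l \<ge> 1" for l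
    unfolding S_def by (rule one_plus_sqrt)+
  have pos: "0 < 1 + S l" for l using S(2)[of l] by linarith
  have dS: "(S has_real_derivative 4 * l / S l) (at l)"
    unfolding S_def by (rule has_real_derivative_sqrt_one_plus)
  have "((\<lambda>l. 2 * l / (1 + S l)) has_real_derivative
      (2 * (1 + S l) - 2 * l * (4 * l / S l)) / ((1 + S l) * (1 + S l))) (at l)"
    using pos[of l] by (auto intro!: derivative_eq_intros dS)
  also have "(\<lambda>l. 2 * l / (1 + S l)) = r0"
    by (simp add: fun_eq_iff r0_eq S_def)
  also have "2 * (1 + S l) - 2 * l * (4 * l / S l) = 2 * (1 + S l) / S l"
    using S(1)[of l] S(2)[of l] by (simp add: field_simps power2_eq_square)
  also have "2 * (1 + S l) / S l / ((1 + S l) * (1 + S l)) = 2 / (S l * (1 + S l))"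
    using S(2)[of l] by (simp add: divide_simps)
  finally show ?thesis .
qed

text \<open>The critical point equation \<open>r = l * (1 - r\<^sup>2)\<close> is linear in
  \<open>l\<close>, so \<open>r0\<close> is inverted by solving for \<open>l\<close>; conversely,
  \<open>r0_unique_root\<close> recognises \<open>c\<close> as the critical point.\<close>

lemma r0_eq_iff:
  assumes "0 < c" "c < 1"
  shows "r0 l = c \<longleftrightarrow> l = c / (1 - c\<^sup>2)"
proof -
  have c2: "c\<^sup>2 < 1" using assms by (simp add: abs_square_less_1)
  have root: "r0 l = l * (1 - (r0 l)\<^sup>2)" for l
    unfolding one_minus_r0_squared by (simp add: r0_eq)
  have "r0 l = c" if "l = c / (1 - c\<^sup>2)"
  proof -
    have "(h_fun l has_real_derivative 0) (at c)"
      using h_fun_deriv[of c l] assms by (simp add: that)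
    then show ?thesis using r0_unique_root[of c l] assms by simp
  qed
  moreover have "l = c / (1 - c\<^sup>2)" if "r0 l = c"
    using root[of l] that c2 by (simp add: field_simps)
  ultimately show ?thesis by blast
qed

lemma sqrt_one_plus_lambda_c:
  fixes c :: real
  assumes "0 < c" "c < 1"
  shows "sqrt (1 + 4 * (c / (1 - c\<^sup>2))\<^sup>2) = (1 + c\<^sup>2) / (1 - c\<^sup>2)"
proof (rule real_sqrt_unique)
  have c2: "c\<^sup>2 < 1" using assms by (simp add: abs_square_less_1)
  then show "((1 + c\<^sup>2) / (1 - c\<^sup>2))\<^sup>2 = 1 + 4 * (c / (1 - c\<^sup>2))\<^sup>2"
    by (simp add: power_divide divide_simps) (simp add: power2_eq_square algebra_simps)
  show "0 \<le> (1 + c\<^sup>2) / (1 - c\<^sup>2)" using c2 by simp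
qed

text \<open>The derivative of \<open>L_fun\<close> is \<open>r0\<close>, so the saddle point is the
  unique \<open>l\<close> at which \<open>r0\<close> takes the value \<open>c\<close>, and
  \<open>sigma_c\<close> comes from the derivative of \<open>r0\<close> there. Uniqueness is what
  gives the definite description in \<open>lambda_c\<close> its value.\<close>

lemma L_fun_facts:
  assumes c: "0 < c" "c < 1"
  shows ex1_L_fun_deriv: "\<exists>!l. (L_fun has_real_derivative c) (at l)"
    and lambda_c_eq: "lambda_c c = c / (1 - c\<^sup>2)"
    and deriv_L_fun_has_derivative: "(deriv L_fun has_real_derivative (sigma_c c)\<^sup>2) (at (lambda_c c))"
    and sigma_c_squared: "(sigma_c c)\<^sup>2 = (1 - c\<^sup>2)\<^sup>2 / (1 + c\<^sup>2)"
    and sigma_c_pos: "sigma_c c > 0"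
proof -
  have c2: "c\<^sup>2 < 1" using c by (simp add: abs_square_less_1)
  have iff: "(L_fun has_real_derivative c) (at l) \<longleftrightarrow> l = c / (1 - c\<^sup>2)" for l
    using L_fun_has_derivative[of l] r0_eq_iff[OF c, of l] DERIV_unique by metis
  show "\<exists>!l. (L_fun has_real_derivative c) (at l)" by (simp add: iff)
  show lam: "lambda_c c = c / (1 - c\<^sup>2)" by (simp add: lambda_c_def iff)
  have dL: "deriv L_fun = r0" using L_fun_has_derivative by (auto intro: DERIV_imp_deriv)
  have "2 / ((1 + c\<^sup>2) / (1 - c\<^sup>2) * (1 + (1 + c\<^sup>2) / (1 - c\<^sup>2))) = (1 - c\<^sup>2)\<^sup>2 / (1 + c\<^sup>2)"
  proof -
    have "1 + (1 + c\<^sup>2) / (1 - c\<^sup>2) = 2 / (1 - c\<^sup>2)" using c2 by (simp add: field_simps)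
    moreover have "2 / (b / a * (2 / a)) = a\<^sup>2 / b" for a b :: real
      by (simp add: power2_eq_square)
    ultimately show ?thesis by (simp only:)
  qed
  then have d2: "(deriv L_fun has_real_derivative (1 - c\<^sup>2)\<^sup>2 / (1 + c\<^sup>2)) (at (lambda_c c))"
    using r0_has_derivative[of "lambda_c c"] by (simp add: dL lam sqrt_one_plus_lambda_c[OF c])
  have pos: "(1 - c\<^sup>2)\<^sup>2 / (1 + c\<^sup>2) > 0" using c2 by (auto intro!: divide_pos_pos add_pos_nonneg)
  have sig: "sigma_c c = sqrt ((1 - c\<^sup>2)\<^sup>2 / (1 + c\<^sup>2))"
    using DERIV_imp_deriv[OF d2] by (simp add: sigma_c_def)
  show sq: "(sigma_c c)\<^sup>2 = (1 - c\<^sup>2)\<^sup>2 / (1 + c\<^sup>2)"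
    unfolding sig using pos by (intro real_sqrt_pow2) simp
  show "sigma_c c > 0" unfolding sig using pos by simp
  show "(deriv L_fun has_real_derivative (sigma_c c)\<^sup>2) (at (lambda_c c))"
    using d2 by (simp add: sq)
qed

text \<open>With \<open>a = 1 - c\<^sup>2\<close> and \<open>b = 1 + c\<^sup>2\<close>, the three
  terms of the exponent contribute \<open>a powr (n / 2)\<close>, \<open>sqrt (a / b)\<close> and
  \<open>a powr (- 3 / 2)\<close>, together \<open>sqrt a ^ (n - 2) / sqrt b\<close>. In the
  denominator \<open>lambda_c c * sigma_c c = c / sqrt b\<close>, so \<open>sqrt b\<close>
  cancels.\<close>

lemma saddlepoint_term_eq:
  assumes c: "0 < c" "c < 1" and n: "n > 2"
  shows "exp (- real n * L_star c - 1/4 * ln (1 + 4 * (lambda_c c)\<^sup>2)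
           + 3/2 * ln ((1 + sqrt (1 + 4 * (lambda_c c)\<^sup>2)) / 2))
         / (lambda_c c * sigma_c c * sqrt (2 * pi * real n))
       = sqrt (1 - c\<^sup>2) ^ (n - 2) / (c * sqrt (2 * pi * real n))"
proof -
  have c2: "c\<^sup>2 < 1" using c by (simp add: abs_square_less_1)
  define a where "a = 1 - c\<^sup>2"
  define b where "b = 1 + c\<^sup>2"
  have ab: "a > 0" "b > 0" using c2 by (auto simp: a_def b_def add_pos_nonneg)
  have s: "sqrt (1 + 4 * (lambda_c c)\<^sup>2) = b / a"
    using sqrt_one_plus_lambda_c[OF c] lambda_c_eq[OF c] by (simp add: a_def b_def)
  have "1 + 4 * (lambda_c c)\<^sup>2 = (b / a)\<^sup>2"
    using one_plus_sqrt(1)[of "lambda_c c"] by (simp add: s)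
  then have l1: "ln (1 + 4 * (lambda_c c)\<^sup>2) = 2 * (ln b - ln a)"
    using ab by (simp add: ln_realpow ln_div)
  have "a + b = 2" by (simp add: a_def b_def)
  then have "(1 + b / a) / 2 = 1 / a" using ab by (simp add: field_simps)
  then have l2: "ln ((1 + sqrt (1 + 4 * (lambda_c c)\<^sup>2)) / 2) = - ln a"
    using ab by (simp add: s ln_div)
  have sig: "sigma_c c = a / sqrt b"
  proof -
    have "sqrt (a\<^sup>2 / b) = sigma_c c"
      using sigma_c_squared[OF c] sigma_c_pos[OF c] unfolding a_def b_def
      by (intro real_sqrt_unique) auto
    then show ?thesis using ab by (simp add: real_sqrt_divide)
  qed
  have "exp (- real n * L_star c - 1/4 * ln (1 + 4 * (lambda_c c)\<^sup>2)
           + 3/2 * ln ((1 + sqrt (1 + 4 * (lambda_c c)\<^sup>2)) / 2))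
      = exp ((real n - 2) * (ln a / 2) - ln b / 2)"
    by (simp add: l1 l2 L_star_def a_def[symmetric] algebra_simps)
  also have "\<dots> = exp (ln a / 2) ^ (n - 2) / exp (ln b / 2)"
    using n by (simp add: exp_diff exp_of_nat_mult[symmetric] of_nat_diff)
  also have "\<dots> = sqrt a ^ (n - 2) / sqrt b"
    using ab by (simp add: ln_sqrt[symmetric])
  finally have e: "exp (- real n * L_star c - 1/4 * ln (1 + 4 * (lambda_c c)\<^sup>2)
           + 3/2 * ln ((1 + sqrt (1 + 4 * (lambda_c c)\<^sup>2)) / 2)) = sqrt a ^ (n - 2) / sqrt b" .
  have "lambda_c c * sigma_c c = c / sqrt b"
    using ab by (simp add: sig lambda_c_eq[OF c, folded a_def])
  then show ?thesis unfolding e a_def[symmetric] using ab by simp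
qed

section \<open>Asymptotics of the cone probability\<close>

text \<open>The point \<open>x + 1/2\<close> is the midpoint of \<open>x\<close> and
  \<open>x + 1\<close>, so log-convexity bounds the left side by
  \<open>Gamma x * Gamma (x + 1)\<close>.\<close>

lemma Gamma_plus_half_le:
  fixes x :: real
  assumes "x > 0"
  shows "(Gamma (x + 1/2))\<^sup>2 \<le> x * (Gamma x)\<^sup>2"
proof -
  have "ln (Gamma ((1 - 1/2) *\<^sub>R x + (1/2) *\<^sub>R (x + 1)))
      \<le> (1 - 1/2) * ln (Gamma x) + (1/2) * ln (Gamma (x + 1))"
    using convex_onD[OF log_convex_Gamma_real, of "1/2" x "x + 1"] assms by (simp only: o_def) simp
  also have "(1 - 1/2) *\<^sub>R x + (1/2) *\<^sub>R (x + 1) = x + 1/2" by (simp add: field_simps)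
  finally have "2 * ln (Gamma (x + 1/2)) \<le> ln (Gamma x) + ln (Gamma (x + 1))" by simp
  moreover have pos: "Gamma x > 0" "Gamma (x + 1/2) > 0" "Gamma (x + 1) > 0"
    using assms by (auto intro: Gamma_real_pos)
  ultimately have "ln ((Gamma (x + 1/2))\<^sup>2) \<le> ln (Gamma x * Gamma (x + 1))"
    by (simp add: ln_realpow ln_mult)
  then have "(Gamma (x + 1/2))\<^sup>2 \<le> Gamma x * Gamma (x + 1)"
    using pos by (subst (asm) ln_le_cancel_iff) auto
  also have "Gamma (x + 1) = x * Gamma x"
    using assms by (intro Gamma_plus1) auto
  finally show ?thesis by (simp add: power2_eq_square mult_ac)
qed

lemma unit_ball_vol_ratio:
  "unit_ball_vol (real k) / unit_ball_vol (real (Suc k))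
     = Gamma (real k / 2 + 1 + 1/2) / (sqrt pi * Gamma (real k / 2 + 1))"
proof -
  have "pi powr (real (Suc k) / 2) = pi powr (real k / 2) * sqrt pi"
    by (simp add: powr_half_sqrt [symmetric] powr_add [symmetric] field_simps)
  moreover have "real (Suc k) / 2 + 1 = real k / 2 + 1 + 1/2" by (simp add: field_simps)
  ultimately show ?thesis by (simp add: unit_ball_vol_def del: of_nat_Suc)
qed

text \<open>Using \<open>Gamma_plus_half_le\<close> at \<open>x = k / 2 + 1\<close> and at
  \<open>x + 1/2\<close> squeezes the squared Gamma quotient between
  \<open>x\<^sup>2 / (x + 1/2)\<close> and \<open>x\<close>, both asymptotic to
  \<open>k / 2\<close>. No Stirling formula is needed.\<close>

lemma unit_ball_vol_ratio_tendsto: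
  "(\<lambda>k. unit_ball_vol (real k) / unit_ball_vol (real (Suc k)) / sqrt (real k))
     \<longlonglongrightarrow> 1 / sqrt (2 * pi)"
proof -
  define q where "q = (\<lambda>k. (Gamma (real k / 2 + 1 + 1/2) / Gamma (real k / 2 + 1))\<^sup>2)"
  have up: "q k \<le> real k / 2 + 1" for k
  proof -
    have "Gamma (real k / 2 + 1) > 0" by (rule Gamma_real_pos) simp
    then show ?thesis
      using Gamma_plus_half_le[of "real k / 2 + 1"] by (simp add: q_def power_divide divide_le_eq)
  qed
  have low: "(real k / 2 + 1)\<^sup>2 / (real k / 2 + 3/2) \<le> q k" for k
  proof -
    define x where "x = real k / 2 + 1"
    have x: "x > 0" by (simp add: x_def)
    have g: "Gamma x > 0" "Gamma (x + 1/2) > 0" using x by (auto intro: Gamma_real_pos)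
    have "(Gamma (x + 1/2 + 1/2))\<^sup>2 \<le> (x + 1/2) * (Gamma (x + 1/2))\<^sup>2"
      using x by (intro Gamma_plus_half_le) simp
    also have "Gamma (x + 1/2 + 1/2) = x * Gamma x"
      using x Gamma_plus1[of x] nonpos_Ints_nonpos[of x] by (force simp: add.commute)
    finally have "(x * Gamma x)\<^sup>2 \<le> (x + 1/2) * (Gamma (x + 1/2))\<^sup>2" .
    then have "x\<^sup>2 * (Gamma x)\<^sup>2 \<le> (Gamma (x + 1/2))\<^sup>2 * (x + 1/2)"
      by (simp only: power_mult_distrib mult.commute)
    then have "x\<^sup>2 / (x + 1/2) \<le> (Gamma (x + 1/2))\<^sup>2 / (Gamma x)\<^sup>2"
      using g x
      by (simp only: pos_divide_le_eq pos_le_divide_eq times_divide_eq_left zero_less_power add_pos_pos zero_less_divide_1_iff zero_less_numeral)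
    moreover have "x + 1/2 = real k / 2 + 3/2" by (simp add: x_def)
    ultimately show ?thesis
      by (simp only: q_def x_def[symmetric] power_divide)
  qed
  have "(\<lambda>k. q k / real k) \<longlonglongrightarrow> 1/2"
  proof (rule tendsto_sandwich)
    show "\<forall>\<^sub>F k in sequentially. (real k / 2 + 1)\<^sup>2 / (real k / 2 + 3/2) / real k \<le> q k / real k"
      using low by (intro always_eventually allI divide_right_mono) auto
    show "\<forall>\<^sub>F k in sequentially. q k / real k \<le> (real k / 2 + 1) / real k"
      using up by (intro always_eventually allI divide_right_mono) auto
    show "(\<lambda>k. (real k / 2 + 1)\<^sup>2 / (real k / 2 + 3/2) / real k) \<longlonglongrightarrow> 1/2"
      by real_asymp (simp add: power2_eq_square)
    show "(\<lambda>k. (real k / 2 + 1) / real k) \<longlonglongrightarrow> 1/2"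
      by real_asymp
  qed
  then have "(\<lambda>k. sqrt (q k / real k) / sqrt pi) \<longlonglongrightarrow> sqrt (1/2) / sqrt pi"
    by (rule tendsto_divide[OF tendsto_real_sqrt tendsto_const]) simp
  moreover have "sqrt (q k / real k) / sqrt pi
      = unit_ball_vol (real k) / unit_ball_vol (real (Suc k)) / sqrt (real k)" for k
  proof -
    have "Gamma (real k / 2 + 1) > 0" "Gamma (real k / 2 + 1 + 1/2) > 0"
      by (auto intro!: Gamma_real_pos simp: add_nonneg_pos)
    then show ?thesis unfolding unit_ball_vol_ratio q_def
      by (simp add: real_sqrt_divide)
  qed
  ultimately show ?thesis by (simp add: real_sqrt_divide real_sqrt_mult)
qed

section \<open>Asymptotics of the integral over the cap, and of the cone probability\<close>

definition cap_integral :: "real \<Rightarrow> nat \<Rightarrow> real" where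
  "cap_integral c k = integral {c..1} (\<lambda>t. sqrt (1 - t\<^sup>2) ^ k)"

lemma cap_integral_nonneg: "0 \<le> c \<Longrightarrow> 0 \<le> cap_integral c k"
  unfolding cap_integral_def
  by (intro integral_nonneg integrable_continuous_real continuous_intros) (auto simp: abs_square_le_1)

text \<open>Differentiating the upper bound in \<open>c\<close> reproduces the integrand up to a factor
  \<open>1 + O(1 / k)\<close>.\<close>

lemma cap_integral_bounds:
  assumes c: "0 < c" "c < 1"
  defines "A \<equiv> \<lambda>k. sqrt (1 - c\<^sup>2) ^ (k + 2) / (real (k + 2) * c)"
  shows "cap_integral c k \<le> A k" "A k \<le> cap_integral c k * (1 + 1 / (real (k + 2) * c\<^sup>2))"
proof -
  define f where "f = (\<lambda>t::real. sqrt (1 - t\<^sup>2) ^ k)"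
  define g where "g = (\<lambda>t::real. sqrt (1 - t\<^sup>2) ^ (k + 2) / (real (k + 2) * t\<^sup>2))"
  \<comment> \<open>\<open>G\<close> is minus the upper bound with its lower endpoint made variable.
    It vanishes at 1, and \<open>g\<close> is the error term that its derivative leaves besides the
    integrand \<open>f\<close>.\<close>
  define G where "G = (\<lambda>t::real. - (sqrt (1 - t\<^sup>2) ^ (k + 2) / (real (k + 2) * t)))"
  have fi: "f integrable_on {c..1}" unfolding f_def
    by (intro integrable_continuous_real continuous_intros)
  have gi: "g integrable_on {c..1}" unfolding g_def using c
    by (intro integrable_continuous_real continuous_intros) auto
  have "((\<lambda>t. f t + g t) has_integral (G 1 - G c)) {c..1}"
  \<comment> \<open>The square root is not differentiable where its argument vanishes, at
    \<open>t = 1\<close>; the derivative is computed in the open interval only, and continuity of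
    \<open>G\<close> covers the endpoints.\<close>
  proof (rule fundamental_theorem_of_calculus_interior)
    show "c \<le> 1" using c by simp
    show "continuous_on {c..1} G" unfolding G_def using c by (intro continuous_intros) auto
    fix t assume t: "t \<in> {c<..<1}"
    define s where "s = sqrt (1 - t\<^sup>2)"
    have t01: "0 < t" "t < 1" using t c by auto
    then have "t\<^sup>2 < 1" by (simp add: abs_square_less_1)
    then have s: "s > 0" by (simp add: s_def)
    have ds: "((\<lambda>t. sqrt (1 - t\<^sup>2)) has_real_derivative - t / s) (at t)"
      using \<open>t\<^sup>2 < 1\<close> by (auto intro!: derivative_eq_intros simp: s_def field_simps)
    have "(G has_real_derivative
       - (((real (k + 2) * (- t / s * s ^ (k + 1))) * (real (k + 2) * t) - s ^ (k + 2) * real (k + 2))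
           / ((real (k + 2) * t) * (real (k + 2) * t)))) (at t)"
    proof -
      have "((\<lambda>t. sqrt (1 - t\<^sup>2) ^ (k + 2)) has_real_derivative
          real (k + 2) * (- t / s * s ^ (k + 1))) (at t)"
        using DERIV_power[OF ds, of "k + 2"] by (simp add: s_def[symmetric] mult_ac)
      moreover have "((\<lambda>t. real (k + 2) * t) has_real_derivative real (k + 2)) (at t)"
        by (rule DERIV_cmult_Id)
      ultimately show ?thesis
        unfolding G_def s_def using t01 by (intro DERIV_minus DERIV_divide) auto
    qed
    also have "- (((real (k + 2) * (- t / s * s ^ (k + 1))) * (real (k + 2) * t) - s ^ (k + 2) * real (k + 2))
           / ((real (k + 2) * t) * (real (k + 2) * t))) = f t + g t"
    proof -
      have "- t / s * s ^ (k + 1) = - t * s ^ k" using s by simp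
      moreover have "- ((m * (- t * p) * (m * t) - r * m) / (m * t * (m * t))) = p + r / (m * t\<^sup>2)"
        if "m > 0" for m p r :: real
        using that t01 by (simp add: divide_simps power2_eq_square) (simp add: algebra_simps)
      ultimately show ?thesis unfolding f_def g_def s_def[symmetric] by simp
    qed
    finally show "(G has_vector_derivative f t + g t) (at t)"
      by (simp add: has_real_derivative_iff_has_vector_derivative)
  qed
  then have "integral {c..1} f + integral {c..1} g = A k"
    using fi gi by (simp add: integral_unique integral_add[symmetric] G_def A_def)
  moreover have "0 \<le> integral {c..1} g"
  proof (intro integral_nonneg gi)
    fix t assume "t \<in> {c..1}"
    then have "t\<^sup>2 \<le> 1" "0 < t" using c by (auto simp: abs_square_le_1)
    then show "0 \<le> g t" unfolding g_def
      by (intro divide_nonneg_nonneg zero_le_power mult_nonneg_nonneg) auto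
  qed
  \<comment> \<open>Two of the \<open>k + 2\<close> factors \<open>sqrt (1 - t\<^sup>2)\<close> are
    bounded by 1, and \<open>t\<close> in the denominator by \<open>c\<close>.\<close>
  moreover have "integral {c..1} g \<le> integral {c..1} (\<lambda>t. f t * (1 / (real (k + 2) * c\<^sup>2)))"
  proof (rule integral_le[OF gi])
    show "(\<lambda>t. f t * (1 / (real (k + 2) * c\<^sup>2))) integrable_on {c..1}"
      using fi by (rule integrable_on_mult_left)
    fix t assume t: "t \<in> {c..1}"
    then have t2: "t\<^sup>2 \<le> 1" "c\<^sup>2 \<le> t\<^sup>2" using c by (auto simp: abs_square_le_1 power_mono)
    have "sqrt (1 - t\<^sup>2) ^ (k + 2) \<le> sqrt (1 - t\<^sup>2) ^ k"
      using t2 by (intro power_decreasing) auto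
    then have "g t \<le> f t / (real (k + 2) * c\<^sup>2)" unfolding g_def f_def
      using t2 c by (intro frac_le mult_left_mono mult_pos_pos) auto
    then show "g t \<le> f t * (1 / (real (k + 2) * c\<^sup>2))" by simp
  qed
  ultimately show "cap_integral c k \<le> A k"
      "A k \<le> cap_integral c k * (1 + 1 / (real (k + 2) * c\<^sup>2))"
    by (auto simp: cap_integral_def f_def[symmetric] algebra_simps)
qed

text \<open>Since \<open>s ^ (k + 2) = (1 - c\<^sup>2) * s ^ k\<close> for
  \<open>s = sqrt (1 - c\<^sup>2)\<close>, the powers cancel in both bounds, and what remains
  differs only by the factor \<open>1 + 1 / ((k + 2) * c\<^sup>2)\<close>, which tends to 1.\<close>

lemma cap_integral_tendsto:
  assumes c: "0 < c" "c < 1"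
  shows "(\<lambda>k. real k * cap_integral c k / sqrt (1 - c\<^sup>2) ^ k) \<longlonglongrightarrow> (1 - c\<^sup>2) / c"
proof -
  define s where "s = sqrt (1 - c\<^sup>2)"
  have c2: "c\<^sup>2 < 1" using c by (simp add: abs_square_less_1)
  have s: "s > 0" "s\<^sup>2 = 1 - c\<^sup>2" using c2 by (auto simp: s_def)
  have sk: "s ^ (k + 2) = (1 - c\<^sup>2) * s ^ k" for k
    unfolding s(2)[symmetric] by (simp add: power2_eq_square)
  note b = cap_integral_bounds[OF c, folded s_def, unfolded sk]
  show ?thesis unfolding s_def[symmetric]
  proof (rule tendsto_sandwich)
    show "\<forall>\<^sub>F k in sequentially. real k * ((1 - c\<^sup>2) / (real (k + 2) * c)) / (1 + 1 / (real (k + 2) * c\<^sup>2))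
        \<le> real k * cap_integral c k / s ^ k"
    proof (intro always_eventually allI)
      fix k
      have "0 < 1 + 1 / (real (k + 2) * c\<^sup>2)" using c by (intro add_pos_pos divide_pos_pos) auto
      then have "(1 - c\<^sup>2) * s ^ k / (real (k + 2) * c) / (1 + 1 / (real (k + 2) * c\<^sup>2)) \<le> cap_integral c k"
        using b(2)[of k] by (simp only: pos_divide_le_eq)
      then have "real k * ((1 - c\<^sup>2) * s ^ k / (real (k + 2) * c) / (1 + 1 / (real (k + 2) * c\<^sup>2))) / s ^ k
          \<le> real k * cap_integral c k / s ^ k"
        using s by (intro divide_right_mono mult_left_mono) auto
      then show "real k * ((1 - c\<^sup>2) / (real (k + 2) * c)) / (1 + 1 / (real (k + 2) * c\<^sup>2))
        \<le> real k * cap_integral c k / s ^ k" using s by simp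
    qed
    show "\<forall>\<^sub>F k in sequentially. real k * cap_integral c k / s ^ k
        \<le> real k * ((1 - c\<^sup>2) / (real (k + 2) * c))"
    proof (intro always_eventually allI)
      fix k
      have "real k * cap_integral c k / s ^ k
          \<le> real k * ((1 - c\<^sup>2) * s ^ k / (real (k + 2) * c)) / s ^ k"
        using s b(1)[of k] by (intro divide_right_mono mult_left_mono) auto
      then show "real k * cap_integral c k / s ^ k \<le> real k * ((1 - c\<^sup>2) / (real (k + 2) * c))"
        using s by simp
    qed
    show "(\<lambda>k. real k * ((1 - c\<^sup>2) / (real (k + 2) * c)) / (1 + 1 / (real (k + 2) * c\<^sup>2)))
        \<longlonglongrightarrow> (1 - c\<^sup>2) / c"
      using c by real_asymp (simp add: divide_inverse)
    show "(\<lambda>k. real k * ((1 - c\<^sup>2) / (real (k + 2) * c))) \<longlonglongrightarrow> (1 - c\<^sup>2) / c"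
      using c by real_asymp (simp add: divide_inverse)
  qed
qed

text \<open>The fraction of the unit ball of dimension \<open>k + 1\<close> filled by the vectors
  that make an angle of cosine at least \<open>c\<close> with a fixed axis. The first summand
  belongs to the straight cone below height \<open>c\<close>, the second to the spherical cap above
  it.\<close>

definition cone_prob :: "real \<Rightarrow> nat \<Rightarrow> real" where
  "cone_prob c k = unit_ball_vol (real k) / unit_ball_vol (real (Suc k))
     * (c * sqrt (1 - c\<^sup>2) ^ k / real (Suc k) + cap_integral c k)"

lemma cone_prob_nonneg:
  assumes "0 \<le> c" "c \<le> 1"
  shows "0 \<le> cone_prob c k"
proof -
  have "c\<^sup>2 \<le> 1" using assms by (simp add: abs_square_le_1)
  then show ?thesis unfolding cone_prob_def using assms cap_integral_nonneg[of c k]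
    by (intro mult_nonneg_nonneg divide_nonneg_nonneg add_nonneg_nonneg) auto
qed

text \<open>Cone and cap both have order \<open>sqrt (1 - c\<^sup>2) ^ k / k\<close>, with constants
  \<open>c\<close> and \<open>(1 - c\<^sup>2) / c\<close> that add up to \<open>1 / c\<close>. The
  ratio of ball volumes contributes \<open>sqrt (k / (2 * pi))\<close>.\<close>

lemma cone_prob_asymp:
  assumes c: "0 < c" "c < 1"
  shows "(\<lambda>n. cone_prob c (n - 2)) \<sim>[at_top]
           (\<lambda>n. sqrt (1 - c\<^sup>2) ^ (n - 2) / (c * sqrt (2 * pi * real n)))"
proof -
  define s where "s = sqrt (1 - c\<^sup>2)"
  define R where "R = (\<lambda>k. unit_ball_vol (real k) / unit_ball_vol (real (Suc k)))"
  have c2: "c\<^sup>2 < 1" using c by (simp add: abs_square_less_1)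
  have s: "s > 0" using c2 by (auto simp: s_def)
  \<comment> \<open>Here \<open>k = n - 2\<close>; the last factor turns \<open>sqrt k\<close> into
    the \<open>sqrt n\<close> of the claim and tends to 1.\<close>
  have "(\<lambda>k. (R k / sqrt (real k)) * (c * (real k / real (Suc k)) + real k * cap_integral c k / s ^ k)
            * (c * sqrt (2 * pi)) * sqrt (real (k + 2) / real k))
        \<longlonglongrightarrow> (1 / sqrt (2 * pi)) * (c * 1 + (1 - c\<^sup>2) / c) * (c * sqrt (2 * pi)) * sqrt 1"
    unfolding R_def s_def
    by (intro tendsto_mult tendsto_add tendsto_const unit_ball_vol_ratio_tendsto cap_integral_tendsto c
        tendsto_real_sqrt) real_asymp+
  also have "(1 / sqrt (2 * pi)) * (c * 1 + (1 - c\<^sup>2) / c) * (c * sqrt (2 * pi)) * sqrt 1 = 1"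
    using c by (simp add: field_simps power2_eq_square)
  finally have lim: "(\<lambda>k. (R k / sqrt (real k)) * (c * (real k / real (Suc k)) + real k * cap_integral c k / s ^ k)
            * (c * sqrt (2 * pi)) * sqrt (real (k + 2) / real k)) \<longlonglongrightarrow> 1" .
  have eq: "(R k / sqrt (real k)) * (c * (real k / real (Suc k)) + real k * cap_integral c k / s ^ k)
            * (c * sqrt (2 * pi)) * sqrt (real (k + 2) / real k)
      = cone_prob c k / (s ^ k / (c * sqrt (2 * pi * real (k + 2))))" if k: "k > 0" for k
  proof -
    have e1: "c * (real k / real (Suc k)) + real k * cap_integral c k / s ^ k
        = real k / s ^ k * (c * s ^ k / real (Suc k) + cap_integral c k)"
      using s by (simp add: field_simps)
    have e2: "sqrt (real (k + 2) / real k) = sqrt (real (k + 2)) / sqrt (real k)"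
      by (simp add: real_sqrt_divide)
    have e3: "sqrt (2 * pi * real (k + 2)) = sqrt (2 * pi) * sqrt (real (k + 2))"
      by (simp only: real_sqrt_mult)
    have key: "(r / q) * (real k / p * z) * (c * u) * (v / q) = r * z / (p / (c * (u * v)))"
      if "q * q = real k" "p \<noteq> 0" for p q r u v z
      using that k c by (auto simp: field_simps)
    show ?thesis
      unfolding cone_prob_def fun_cong[OF R_def, symmetric] s_def[symmetric] e1 e2 e3
      by (rule key) (use s in auto)
  qed
  have "(\<lambda>k. cone_prob c k / (s ^ k / (c * sqrt (2 * pi * real (k + 2))))) \<longlonglongrightarrow> 1"
    by (rule Lim_transform_eventually[OF lim]) (use eq in \<open>auto intro: eventually_sequentiallyI[of 1]\<close>)
  then have "(\<lambda>n. cone_prob c (n + 2 - 2) / (s ^ (n + 2 - 2) / (c * sqrt (2 * pi * real (n + 2))))) \<longlonglongrightarrow> 1"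
    by simp
  then have lim2: "(\<lambda>n. cone_prob c (n - 2) / (s ^ (n - 2) / (c * sqrt (2 * pi * real n)))) \<longlonglongrightarrow> 1"
    by (rule LIMSEQ_offset)
  have "eventually (\<lambda>n. s ^ (n - 2) / (c * sqrt (2 * pi * real n)) \<noteq> 0) sequentially"
    using s c by (intro eventually_sequentiallyI[of 1]) auto
  then show ?thesis unfolding s_def[symmetric]
    using lim2 by (intro asymp_equivI') auto
qed

section \<open>Rotation invariance and cone volumes\<close>

text \<open>A plane rotation is carried out by one-dimensional affine substitutions: first
  \<open>t\<close> is replaced by \<open>p = a * t + b * y\<close> for fixed \<open>y\<close>, then,
  after Fubini, \<open>y\<close> by the second coordinate for fixed \<open>p\<close>. The Jacobian
  factors cancel. As this divides by \<open>a\<close>, the case \<open>a = 0\<close>, an exchange of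
  variables up to sign, is treated apart.\<close>

lemma nn_integral_lborel_rotate:
  fixes f :: "real \<Rightarrow> real \<Rightarrow> ennreal"
  assumes f [measurable]: "(\<lambda>(x, y). f x y) \<in> borel_measurable (borel \<Otimes>\<^sub>M borel)"
    and ab: "a\<^sup>2 + b\<^sup>2 = 1"
  shows "(\<integral>\<^sup>+y. \<integral>\<^sup>+t. f (a * t + b * y) (a * y - b * t) \<partial>lborel \<partial>lborel)
       = (\<integral>\<^sup>+y. \<integral>\<^sup>+t. f t y \<partial>lborel \<partial>lborel)" (is "?L = ?R")
proof (cases "a = 0")
  case True
  then have b: "\<bar>b\<bar> = 1" using ab by (simp add: power2_eq_1_iff) (auto simp: abs_if)
  then have b0: "b \<noteq> 0" by auto
  have "?L = (\<integral>\<^sup>+y. \<integral>\<^sup>+t. f (b * y) (- b * t) \<partial>lborel \<partial>lborel)"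
    using True by simp
  also have "\<dots> = (\<integral>\<^sup>+y. \<integral>\<^sup>+t. f (b * y) t \<partial>lborel \<partial>lborel)"
  proof (rule nn_integral_cong)
    fix y
    show "(\<integral>\<^sup>+t. f (b * y) (- b * t) \<partial>lborel) = (\<integral>\<^sup>+t. f (b * y) t \<partial>lborel)"
      using b0 b by (subst (2) nn_integral_real_affine[where c = "- b" and t = 0]) auto
  qed
  also have "\<dots> = (\<integral>\<^sup>+y. \<integral>\<^sup>+t. f y t \<partial>lborel \<partial>lborel)"
    using b0 b
    by (subst nn_integral_real_affine[where c = b and t = 0 and f = "\<lambda>y. \<integral>\<^sup>+t. f y t \<partial>lborel"]) auto
  also have "\<dots> = ?R" by (rule lborel_pair.Fubini'[symmetric]) measurable
  finally show ?thesis .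
next
  case False
  have inner: "(\<integral>\<^sup>+t. f (a * t + b * y) (a * y - b * t) \<partial>lborel)
      = ennreal \<bar>1 / a\<bar> * (\<integral>\<^sup>+p. f p (y / a - b / a * p) \<partial>lborel)" for y
  proof -
    have "(\<integral>\<^sup>+t. f (a * t + b * y) (a * y - b * t) \<partial>lborel)
      = ennreal \<bar>1 / a\<bar> * (\<integral>\<^sup>+p. f (a * (- (b * y / a) + 1 / a * p) + b * y)
            (a * y - b * (- (b * y / a) + 1 / a * p)) \<partial>lborel)"
      using False by (subst nn_integral_real_affine[where c = "1 / a" and t = "- (b * y / a)"]) auto
    also have "(\<lambda>p. f (a * (- (b * y / a) + 1 / a * p) + b * y)
            (a * y - b * (- (b * y / a) + 1 / a * p))) = (\<lambda>p. f p (y / a - b / a * p))"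
    proof
      fix p
      have "a * y - b * (- (b * y / a) + 1 / a * p) = (a\<^sup>2 + b\<^sup>2) * y / a - b / a * p"
        using False by (simp add: field_simps power2_eq_square)
      moreover have "a * (- (b * y / a) + 1 / a * p) + b * y = p" using False by (simp add: field_simps)
      ultimately show "f (a * (- (b * y / a) + 1 / a * p) + b * y)
            (a * y - b * (- (b * y / a) + 1 / a * p)) = f p (y / a - b / a * p)"
        by (simp add: ab)
    qed
    finally show ?thesis .
  qed
  have outer: "(\<integral>\<^sup>+q. f p q \<partial>lborel) = ennreal \<bar>1 / a\<bar> * (\<integral>\<^sup>+y. f p (y / a - b / a * p) \<partial>lborel)" for p
    using False
    by (subst nn_integral_real_affine[where c = "1 / a" and t = "- (b / a * p)"]) (auto simp: algebra_simps)
  have "?L = (\<integral>\<^sup>+y. \<integral>\<^sup>+p. ennreal \<bar>1 / a\<bar> * f p (y / a - b / a * p) \<partial>lborel \<partial>lborel)"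
    by (simp add: inner nn_integral_cmult)
  also have "\<dots> = (\<integral>\<^sup>+p. \<integral>\<^sup>+y. ennreal \<bar>1 / a\<bar> * f p (y / a - b / a * p) \<partial>lborel \<partial>lborel)"
    by (rule lborel_pair.Fubini') measurable
  also have "\<dots> = (\<integral>\<^sup>+p. \<integral>\<^sup>+q. f p q \<partial>lborel \<partial>lborel)"
    by (simp add: outer nn_integral_cmult)
  also have "\<dots> = ?R" by (rule lborel_pair.Fubini'[symmetric]) measurable
  finally show ?thesis .
qed

text \<open>Each coordinate is rotated in turn against the distinguished variable \<open>t\<close>,
  which replaces the coefficients \<open>(a, u j)\<close> by
  \<open>(sqrt (a\<^sup>2 + (u j)\<^sup>2), 0)\<close> and keeps the sum of squares. The integrand
  \<open>g\<close> is arbitrary so that the induction can absorb coordinates already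
  treated.\<close>

lemma nn_integral_PiM_lborel_rotate:
  fixes g :: "real \<Rightarrow> real \<Rightarrow> ennreal"
  assumes "finite K"
    and "(\<lambda>(p, q). g p q) \<in> borel_measurable (borel \<Otimes>\<^sub>M borel)"
  shows "(\<integral>\<^sup>+x. \<integral>\<^sup>+t. g (a * t + (\<Sum>i\<in>K. u i * x i)) (t\<^sup>2 + (\<Sum>i\<in>K. (x i)\<^sup>2))
            \<partial>lborel \<partial>(Pi\<^sub>M K (\<lambda>_. lborel)))
       = (\<integral>\<^sup>+x. \<integral>\<^sup>+t. g (sqrt (a\<^sup>2 + (\<Sum>i\<in>K. (u i)\<^sup>2)) * t) (t\<^sup>2 + (\<Sum>i\<in>K. (x i)\<^sup>2))
            \<partial>lborel \<partial>(Pi\<^sub>M K (\<lambda>_. lborel)))"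
  using assms
proof (induction arbitrary: a g)
  case empty
  note [measurable] = empty
  \<comment> \<open>With no further coordinates the square root is the absolute value of
    \<open>a\<close>, and the substitution of \<open>- t\<close> for \<open>t\<close> removes the
    sign.\<close>
  have "(\<integral>\<^sup>+t. g (a * t) (t\<^sup>2) \<partial>lborel) = (\<integral>\<^sup>+t. g (\<bar>a\<bar> * t) (t\<^sup>2) \<partial>lborel)"
  proof (cases "a \<ge> 0")
    case False
    then show ?thesis
      by (subst nn_integral_real_affine[where c = "- 1" and t = 0]) auto
  qed simp
  then show ?case by (simp add: PiM_empty nn_integral_count_space_finite)
next
  case (insert j K)
  interpret product_sigma_finite "\<lambda>_::'a. lborel :: real measure" by standard
  note [measurable] = insert.prems
  note fin [simp] = \<open>finite K\<close> \<open>j \<notin> K\<close>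
  define \<rho> where "\<rho> = sqrt (a\<^sup>2 + (u j)\<^sup>2)"
  have \<rho>2: "\<rho>\<^sup>2 = a\<^sup>2 + (u j)\<^sup>2" by (simp add: \<rho>_def)
  have upd: "(\<Sum>i\<in>K. h i (if i = j then y else x i)) = (\<Sum>i\<in>K. h i (x i))"
    for h :: "'a \<Rightarrow> real \<Rightarrow> real" and x y
    using fin by (intro sum.cong) auto
  have rot: "(\<integral>\<^sup>+y. \<integral>\<^sup>+t. g (a * t + (u j * y + S)) (t\<^sup>2 + (y\<^sup>2 + T)) \<partial>lborel \<partial>lborel)
      = (\<integral>\<^sup>+y. \<integral>\<^sup>+t. g (\<rho> * t + S) (t\<^sup>2 + (y\<^sup>2 + T)) \<partial>lborel \<partial>lborel)" for S T
  proof (cases "\<rho> = 0")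
    case True
    then have "a\<^sup>2 + (u j)\<^sup>2 = 0" using \<rho>2 by simp
    then have "a = 0 \<and> u j = 0" by (simp add: sum_power2_eq_zero_iff)
    then show ?thesis using True by simp
  next
    case False
    define \<alpha> where "\<alpha> = a / \<rho>"
    define \<beta> where "\<beta> = u j / \<rho>"
    have ab: "\<alpha>\<^sup>2 + \<beta>\<^sup>2 = 1"
      using False by (simp add: \<alpha>_def \<beta>_def power_divide add_divide_distrib[symmetric] \<rho>2[symmetric])
    have "\<rho> * (\<alpha> * t + \<beta> * y) = a * t + u j * y" for t y
      using False by (simp add: \<alpha>_def \<beta>_def field_simps)
    moreover have "(\<alpha> * t + \<beta> * y)\<^sup>2 + (\<alpha> * y - \<beta> * t)\<^sup>2 = t\<^sup>2 + y\<^sup>2" for t y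
    proof -
      have "(\<alpha> * t + \<beta> * y)\<^sup>2 + (\<alpha> * y - \<beta> * t)\<^sup>2 = (\<alpha>\<^sup>2 + \<beta>\<^sup>2) * (t\<^sup>2 + y\<^sup>2)"
        by (simp add: power2_eq_square algebra_simps)
      then show ?thesis by (simp add: ab)
    qed
    ultimately show ?thesis
      using nn_integral_lborel_rotate[OF _ ab, of "\<lambda>p q. g (\<rho> * p + S) (p\<^sup>2 + q\<^sup>2 + T)"]
      by (simp add: add.assoc)
  qed
  have "(\<integral>\<^sup>+x. \<integral>\<^sup>+t. g (a * t + (\<Sum>i\<in>insert j K. u i * x i)) (t\<^sup>2 + (\<Sum>i\<in>insert j K. (x i)\<^sup>2))
            \<partial>lborel \<partial>(Pi\<^sub>M (insert j K) (\<lambda>_. lborel)))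
      = (\<integral>\<^sup>+x. \<integral>\<^sup>+y. \<integral>\<^sup>+t. g (a * t + (u j * y + (\<Sum>i\<in>K. u i * x i))) (t\<^sup>2 + (y\<^sup>2 + (\<Sum>i\<in>K. (x i)\<^sup>2)))
            \<partial>lborel \<partial>lborel \<partial>(Pi\<^sub>M K (\<lambda>_. lborel)))"
    by (subst product_nn_integral_insert)
       (simp_all add: upd[where h = "\<lambda>i v. u i * v"] upd[where h = "\<lambda>i v. v\<^sup>2"])
  also have "\<dots> = (\<integral>\<^sup>+x. \<integral>\<^sup>+y. \<integral>\<^sup>+t. g (\<rho> * t + (\<Sum>i\<in>K. u i * x i)) (t\<^sup>2 + (y\<^sup>2 + (\<Sum>i\<in>K. (x i)\<^sup>2)))
            \<partial>lborel \<partial>lborel \<partial>(Pi\<^sub>M K (\<lambda>_. lborel)))"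
    by (simp only: rot)
  also have "\<dots> = (\<integral>\<^sup>+x. \<integral>\<^sup>+t. g (\<rho> * t + (\<Sum>i\<in>K. u i * x i)) (t\<^sup>2 + ((x j)\<^sup>2 + (\<Sum>i\<in>K. (x i)\<^sup>2)))
            \<partial>lborel \<partial>(Pi\<^sub>M (insert j K) (\<lambda>_. lborel)))"
    by (subst product_nn_integral_insert)
       (simp_all add: upd[where h = "\<lambda>i v. u i * v"] upd[where h = "\<lambda>i v. v\<^sup>2"])
  \<comment> \<open>Coordinate \<open>j\<close> has left the linear form, so it is integrated
    outermost; its square is then a constant inside the function to which the induction hypothesis
    applies.\<close>
  also have "\<dots> = (\<integral>\<^sup>+y. \<integral>\<^sup>+x. \<integral>\<^sup>+t. g (\<rho> * t + (\<Sum>i\<in>K. u i * x i)) (y\<^sup>2 + (t\<^sup>2 + (\<Sum>i\<in>K. (x i)\<^sup>2)))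
            \<partial>lborel \<partial>(Pi\<^sub>M K (\<lambda>_. lborel)) \<partial>lborel)"
    by (subst product_nn_integral_insert_rev)
       (simp_all add: upd[where h = "\<lambda>i v. u i * v"] upd[where h = "\<lambda>i v. v\<^sup>2"] add.left_commute)
  also have "\<dots> = (\<integral>\<^sup>+y. \<integral>\<^sup>+x. \<integral>\<^sup>+t. g (sqrt (\<rho>\<^sup>2 + (\<Sum>i\<in>K. (u i)\<^sup>2)) * t) (y\<^sup>2 + (t\<^sup>2 + (\<Sum>i\<in>K. (x i)\<^sup>2)))
            \<partial>lborel \<partial>(Pi\<^sub>M K (\<lambda>_. lborel)) \<partial>lborel)"
  proof (rule nn_integral_cong)
    fix y :: real
    show "(\<integral>\<^sup>+x. \<integral>\<^sup>+t. g (\<rho> * t + (\<Sum>i\<in>K. u i * x i)) (y\<^sup>2 + (t\<^sup>2 + (\<Sum>i\<in>K. (x i)\<^sup>2)))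
            \<partial>lborel \<partial>(Pi\<^sub>M K (\<lambda>_. lborel)))
        = (\<integral>\<^sup>+x. \<integral>\<^sup>+t. g (sqrt (\<rho>\<^sup>2 + (\<Sum>i\<in>K. (u i)\<^sup>2)) * t) (y\<^sup>2 + (t\<^sup>2 + (\<Sum>i\<in>K. (x i)\<^sup>2)))
            \<partial>lborel \<partial>(Pi\<^sub>M K (\<lambda>_. lborel)))"
      by (rule insert.IH[of "\<lambda>p q. g p (y\<^sup>2 + q)"]) measurable
  qed
  also have "\<dots> = (\<integral>\<^sup>+x. \<integral>\<^sup>+t. g (sqrt (a\<^sup>2 + (\<Sum>i\<in>insert j K. (u i)\<^sup>2)) * t) (t\<^sup>2 + (\<Sum>i\<in>insert j K. (x i)\<^sup>2))
            \<partial>lborel \<partial>(Pi\<^sub>M (insert j K) (\<lambda>_. lborel)))"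
    by (subst product_nn_integral_insert_rev)
       (simp_all add: upd[where h = "\<lambda>i v. v\<^sup>2"] add.left_commute \<rho>2 add.assoc)
  finally show ?case .
qed

text \<open>The boundary of the cone meets the unit sphere at height \<open>c\<close>. Below that
  height the cone condition implies the ball condition, above it the reverse holds, so a slice at
  height \<open>t\<close> is a ball whose radius comes from the binding condition. \<open>S\<close>
  is the squared distance from the axis.\<close>

lemma spherical_cone_slice:
  fixes c t S :: real
  assumes c: "0 < c" "c < 1" and t: "0 < t" "t < 1" and S: "0 \<le> S"
  shows "0 < t\<^sup>2 + S \<and> t\<^sup>2 + S \<le> 1 \<and> c * sqrt (t\<^sup>2 + S) \<le> t
     \<longleftrightarrow> sqrt S \<le> (if t < c then t * (sqrt (1 - c\<^sup>2) / c) else sqrt (1 - t\<^sup>2))"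
proof -
  have c2: "c\<^sup>2 < 1" using c by (simp add: abs_square_less_1)
  have "c * sqrt (t\<^sup>2 + S) = sqrt (c\<^sup>2 * (t\<^sup>2 + S))"
    using c by (simp add: real_sqrt_mult)
  then have A: "c * sqrt (t\<^sup>2 + S) \<le> t \<longleftrightarrow> c\<^sup>2 * (t\<^sup>2 + S) \<le> t\<^sup>2"
    using t S by (simp add: real_sqrt_le_iff')
  have pos: "0 < t\<^sup>2 + S" using t S by (simp add: add_pos_nonneg)
  show ?thesis
  proof (cases "t < c")
    case True
    have r: "(t * (sqrt (1 - c\<^sup>2) / c))\<^sup>2 = t\<^sup>2 * (1 - c\<^sup>2) / c\<^sup>2"
      using c2 by (simp add: power_mult_distrib power_divide)
    have "0 \<le> t * (sqrt (1 - c\<^sup>2) / c)" using t c c2 by simp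
    then have "sqrt S \<le> t * (sqrt (1 - c\<^sup>2) / c) \<longleftrightarrow> S \<le> t\<^sup>2 * (1 - c\<^sup>2) / c\<^sup>2"
      using S by (simp only: real_sqrt_le_iff' r)
    also have "\<dots> \<longleftrightarrow> c\<^sup>2 * (t\<^sup>2 + S) \<le> t\<^sup>2"
      using c by (simp add: pos_le_divide_eq algebra_simps)
    finally have B: "sqrt S \<le> t * (sqrt (1 - c\<^sup>2) / c) \<longleftrightarrow> c\<^sup>2 * (t\<^sup>2 + S) \<le> t\<^sup>2" .
    have "t\<^sup>2 \<le> c\<^sup>2" using True t by (intro power_mono) auto
    then have "t\<^sup>2 + S \<le> 1" if "c\<^sup>2 * (t\<^sup>2 + S) \<le> t\<^sup>2"
    proof -
      have "c\<^sup>2 * (t\<^sup>2 + S) \<le> c\<^sup>2 * 1" using that \<open>t\<^sup>2 \<le> c\<^sup>2\<close> by simp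
      then show ?thesis using c by (subst (asm) mult_le_cancel_left_pos) auto
    qed
    then show ?thesis using A B pos True by auto
  next
    case False
    have B: "sqrt S \<le> sqrt (1 - t\<^sup>2) \<longleftrightarrow> t\<^sup>2 + S \<le> 1"
      by (simp add: algebra_simps)
    have "c\<^sup>2 \<le> t\<^sup>2" using False c by (intro power_mono) auto
    then have "c\<^sup>2 * (t\<^sup>2 + S) \<le> t\<^sup>2" if "t\<^sup>2 + S \<le> 1"
      using mult_left_mono[OF that, of "c\<^sup>2"] by simp
    then show ?thesis using A B pos False by auto
  qed
qed

text \<open>\<open>p\<close> stands for the inner product with a unit axis and \<open>q\<close> for
  the squared norm. The cone in the punctured unit ball depends on these two numbers only, which is
  the shape that the rotation lemma requires.\<close>

definition cone_ind :: "real \<Rightarrow> real \<Rightarrow> real \<Rightarrow> ennreal" where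
  "cone_ind c p q = (if 0 < q \<and> q \<le> 1 \<and> c * sqrt q \<le> p then 1 else 0)"

lemma measurable_cone_ind [measurable]:
  "(\<lambda>(p, q). cone_ind c p q) \<in> borel_measurable (borel \<Otimes>\<^sub>M borel)"
  unfolding cone_ind_def by measurable

text \<open>Slicing perpendicular to the axis gives balls of radius proportional to \<open>t\<close>
  up to height \<open>c\<close> and of radius \<open>sqrt (1 - t\<^sup>2)\<close> from there to 1;
  their volumes are integrated over the height.\<close>

lemma nn_integral_cone_ind:
  fixes K :: "'a set"
  assumes K: "finite K" and c: "0 < c" "c < 1"
  shows "(\<integral>\<^sup>+x. \<integral>\<^sup>+t. cone_ind c t (t\<^sup>2 + (\<Sum>i\<in>K. (x i)\<^sup>2)) \<partial>lborel \<partial>(Pi\<^sub>M K (\<lambda>_. lborel)))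
    = ennreal (unit_ball_vol (card K) *
        (c * sqrt (1 - c\<^sup>2) ^ card K / Suc (card K) + cap_integral c (card K)))"
proof -
  interpret product_sigma_finite "\<lambda>_::'a. lborel :: real measure" by standard
  interpret PK: sigma_finite_measure "Pi\<^sub>M K (\<lambda>_::'a. lborel :: real measure)"
    using K by (rule sigma_finite)
  interpret pair_sigma_finite "Pi\<^sub>M K (\<lambda>_::'a. lborel :: real measure)" "lborel :: real measure" ..
  define k where "k = card K"
  define \<omega> where "\<omega> = unit_ball_vol (real k)"
  define \<tau> where "\<tau> = sqrt (1 - c\<^sup>2) / c"
  have c2: "c\<^sup>2 < 1" using c by (simp add: abs_square_less_1)
  have \<tau>: "\<tau> > 0" using c c2 by (simp add: \<tau>_def)
  have \<omega>: "\<omega> \<ge> 0" by (simp add: \<omega>_def)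
  \<comment> \<open>The heights 0, \<open>c\<close> and 1 are left out: both indicators are 1 at
    \<open>c\<close>, and the radius degenerates to 0 at the other two. They form a null
    set.\<close>
  have slice: "(\<integral>\<^sup>+x. cone_ind c t (t\<^sup>2 + (\<Sum>i\<in>K. (x i)\<^sup>2)) \<partial>(Pi\<^sub>M K (\<lambda>_. lborel)))
      = ennreal (\<omega> * (t * \<tau>) ^ k) * indicator {0..c} t
        + ennreal (\<omega> * sqrt (1 - t\<^sup>2) ^ k) * indicator {c..1} t"
    if t: "t \<notin> {0, c, 1}" for t
  proof (cases "0 < t \<and> t < 1")
    case True
    define r where "r = (if t < c then t * \<tau> else sqrt (1 - t\<^sup>2))"
    have "t\<^sup>2 < 1" using True by (simp add: abs_square_less_1)
    then have r: "r > 0" using True \<tau> by (simp add: r_def)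
    have "(\<integral>\<^sup>+x. cone_ind c t (t\<^sup>2 + (\<Sum>i\<in>K. (x i)\<^sup>2)) \<partial>(Pi\<^sub>M K (\<lambda>_. lborel)))
        = (\<integral>\<^sup>+x. indicator ({f. sqrt (\<Sum>i\<in>K. (f i)\<^sup>2) \<le> r} \<inter> space (Pi\<^sub>M K (\<lambda>_. lborel))) x
            \<partial>(Pi\<^sub>M K (\<lambda>_. lborel)))"
    proof (rule nn_integral_cong)
      fix x assume "x \<in> space (Pi\<^sub>M K (\<lambda>_. lborel :: real measure))"
      moreover have "0 \<le> (\<Sum>i\<in>K. (x i)\<^sup>2)" by (intro sum_nonneg) auto
      ultimately show "cone_ind c t (t\<^sup>2 + (\<Sum>i\<in>K. (x i)\<^sup>2))
          = indicator ({f. sqrt (\<Sum>i\<in>K. (f i)\<^sup>2) \<le> r} \<inter> space (Pi\<^sub>M K (\<lambda>_. lborel))) x"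
        unfolding cone_ind_def r_def \<tau>_def
        using True by (subst spherical_cone_slice[OF c]) auto
    qed
    also have "\<dots> = emeasure (Pi\<^sub>M K (\<lambda>_. lborel))
        ({f. sqrt (\<Sum>i\<in>K. (f i)\<^sup>2) \<le> r} \<inter> space (Pi\<^sub>M K (\<lambda>_. lborel)))"
    proof (rule nn_integral_indicator)
      have "{x \<in> space (Pi\<^sub>M K (\<lambda>_. lborel :: real measure)). sqrt (\<Sum>i\<in>K. (x i)\<^sup>2) \<le> r}
          \<in> sets (Pi\<^sub>M K (\<lambda>_. lborel))" by measurable
      then show "{f. sqrt (\<Sum>i\<in>K. (f i)\<^sup>2) \<le> r} \<inter> space (Pi\<^sub>M K (\<lambda>_. lborel))
          \<in> sets (Pi\<^sub>M K (\<lambda>_. lborel))" by (simp add: Int_def conj_commute)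
    qed
    also have "\<dots> = ennreal (\<omega> * r ^ k)"
      using emeasure_cball_aux[OF K r] by (simp add: \<omega>_def k_def)
    finally show ?thesis using t True by (auto simp: r_def indicator_def)
  next
    case False
    have "cone_ind c t (t\<^sup>2 + (\<Sum>i\<in>K. (x i)\<^sup>2)) = 0" for x :: "'a \<Rightarrow> real"
    proof -
      have S: "0 \<le> (\<Sum>i\<in>K. (x i)\<^sup>2)" by (intro sum_nonneg) auto
      show ?thesis
      proof (cases "t < 0")
        case True
        have "0 \<le> c * sqrt (t\<^sup>2 + (\<Sum>i\<in>K. (x i)\<^sup>2))" using c S by simp
        then show ?thesis using True by (simp add: cone_ind_def)
      next
        case nneg: False
        then have "t > 1" using t False by auto
        then have "t\<^sup>2 > 1" by (simp add: one_less_power)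
        then show ?thesis using S by (simp add: cone_ind_def)
      qed
    qed
    then show ?thesis using False t c by (auto simp: indicator_def)
  qed
  have "((\<lambda>t. \<omega> * (t * \<tau>) ^ k) has_integral
      (\<omega> * \<tau> ^ k * c ^ Suc k / Suc k - \<omega> * \<tau> ^ k * 0 ^ Suc k / Suc k)) {0..c}"
  proof (rule fundamental_theorem_of_calculus)
    fix t :: real
    have "((\<lambda>t. \<omega> * \<tau> ^ k * t ^ Suc k / Suc k) has_real_derivative
        \<omega> * \<tau> ^ k * (real (Suc k) * t ^ k) / Suc k) (at t within {0..c})"
      using DERIV_pow[of "Suc k" t] by (intro DERIV_cdivide DERIV_cmult) (simp add: has_field_derivative_at_within)
    then show "((\<lambda>t. \<omega> * \<tau> ^ k * t ^ Suc k / Suc k) has_vector_derivative \<omega> * (t * \<tau>) ^ k)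
        (at t within {0..c})"
      by (simp add: has_real_derivative_iff_has_vector_derivative power_mult_distrib mult_ac del: of_nat_Suc)
  qed (use c in auto)
  then have I1: "(\<integral>\<^sup>+t. ennreal (\<omega> * (t * \<tau>) ^ k) * indicator {0..c} t \<partial>lborel)
      = ennreal (\<omega> * \<tau> ^ k * c ^ Suc k / Suc k)"
    using \<omega> \<tau> by (intro nn_integral_has_integral_lebesgue') auto
  have "((\<lambda>t. \<omega> * sqrt (1 - t\<^sup>2) ^ k) has_integral \<omega> * cap_integral c k) {c..1}"
    unfolding cap_integral_def
    by (intro has_integral_mult_right integrable_integral integrable_continuous_real continuous_intros)
  then have I2: "(\<integral>\<^sup>+t. ennreal (\<omega> * sqrt (1 - t\<^sup>2) ^ k) * indicator {c..1} t \<partial>lborel)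
      = ennreal (\<omega> * cap_integral c k)"
    using \<omega> c by (intro nn_integral_has_integral_lebesgue') (auto simp: abs_square_le_1)
  have cap: "0 \<le> cap_integral c k" using c by (intro cap_integral_nonneg) auto
  have "(\<integral>\<^sup>+x. \<integral>\<^sup>+t. cone_ind c t (t\<^sup>2 + (\<Sum>i\<in>K. (x i)\<^sup>2)) \<partial>lborel \<partial>(Pi\<^sub>M K (\<lambda>_. lborel)))
      = (\<integral>\<^sup>+t. \<integral>\<^sup>+x. cone_ind c t (t\<^sup>2 + (\<Sum>i\<in>K. (x i)\<^sup>2)) \<partial>(Pi\<^sub>M K (\<lambda>_. lborel)) \<partial>lborel)"
    by (rule Fubini'[symmetric]) measurable
  also have "\<dots> = (\<integral>\<^sup>+t. (ennreal (\<omega> * (t * \<tau>) ^ k) * indicator {0..c} t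
        + ennreal (\<omega> * sqrt (1 - t\<^sup>2) ^ k) * indicator {c..1} t) \<partial>lborel)"
  proof (rule nn_integral_cong_AE)
    have "AE t in lborel. t \<noteq> 0 \<and> t \<noteq> c \<and> t \<noteq> (1::real)"
      by (intro AE_conjI AE_lborel_singleton)
    then show "AE t in lborel. (\<integral>\<^sup>+x. cone_ind c t (t\<^sup>2 + (\<Sum>i\<in>K. (x i)\<^sup>2)) \<partial>(Pi\<^sub>M K (\<lambda>_. lborel)))
      = ennreal (\<omega> * (t * \<tau>) ^ k) * indicator {0..c} t
        + ennreal (\<omega> * sqrt (1 - t\<^sup>2) ^ k) * indicator {c..1} t"
      by (rule AE_mp) (auto intro!: AE_I2 slice)
  qed
  also have "\<dots> = ennreal (\<omega> * \<tau> ^ k * c ^ Suc k / Suc k) + ennreal (\<omega> * cap_integral c k)"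
    by (subst nn_integral_add) (auto simp: I1 I2)
  also have "\<dots> = ennreal (\<omega> * \<tau> ^ k * c ^ Suc k / Suc k + \<omega> * cap_integral c k)"
    using \<omega> \<tau> c cap by (intro ennreal_plus[symmetric]) auto
  also have "\<tau> ^ k * c ^ Suc k = c * sqrt (1 - c\<^sup>2) ^ k"
    using c by (simp add: \<tau>_def power_divide)
  then have "\<omega> * \<tau> ^ k * c ^ Suc k / Suc k + \<omega> * cap_integral c k
      = \<omega> * (c * sqrt (1 - c\<^sup>2) ^ k / Suc k + cap_integral c k)"
    by (simp add: algebra_simps)
  finally show ?thesis by (simp add: \<omega>_def k_def)
qed

text \<open>Rotation invariance carries any unit axis \<open>v\<close> to a coordinate axis, so the
  volume of the cone does not depend on its direction.\<close>

lemma nn_integral_cone_ind_unit_direction: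
  fixes v :: "'a \<Rightarrow> real"
  assumes K: "finite K" "k \<notin> K" and c: "0 < c" "c < 1"
    and v: "(\<Sum>i\<in>insert k K. (v i)\<^sup>2) = 1"
  shows "(\<integral>\<^sup>+w. cone_ind c (\<Sum>i\<in>insert k K. v i * w i) (\<Sum>i\<in>insert k K. (w i)\<^sup>2)
            \<partial>(Pi\<^sub>M (insert k K) (\<lambda>_. lborel)))
    = ennreal (unit_ball_vol (Suc (card K)) * cone_prob c (card K))"
proof -
  interpret product_sigma_finite "\<lambda>_::'a. lborel :: real measure" by standard
  have upd: "(\<Sum>i\<in>K. h i (if i = k then y else x i)) = (\<Sum>i\<in>K. h i (x i))"
    for h :: "'a \<Rightarrow> real \<Rightarrow> real" and x y
    using K by (intro sum.cong) auto
  have "(\<integral>\<^sup>+w. cone_ind c (\<Sum>i\<in>insert k K. v i * w i) (\<Sum>i\<in>insert k K. (w i)\<^sup>2)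
            \<partial>(Pi\<^sub>M (insert k K) (\<lambda>_. lborel)))
      = (\<integral>\<^sup>+x. \<integral>\<^sup>+t. cone_ind c (v k * t + (\<Sum>i\<in>K. v i * x i)) (t\<^sup>2 + (\<Sum>i\<in>K. (x i)\<^sup>2))
            \<partial>lborel \<partial>(Pi\<^sub>M K (\<lambda>_. lborel)))"
    using K by (subst product_nn_integral_insert)
      (simp_all add: upd[where h = "\<lambda>i y. v i * y"] upd[where h = "\<lambda>i y. y\<^sup>2"])
  also have "\<dots> = (\<integral>\<^sup>+x. \<integral>\<^sup>+t. cone_ind c (sqrt ((v k)\<^sup>2 + (\<Sum>i\<in>K. (v i)\<^sup>2)) * t) (t\<^sup>2 + (\<Sum>i\<in>K. (x i)\<^sup>2))
            \<partial>lborel \<partial>(Pi\<^sub>M K (\<lambda>_. lborel)))"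
    by (rule nn_integral_PiM_lborel_rotate[OF K(1)]) measurable
  also have "(v k)\<^sup>2 + (\<Sum>i\<in>K. (v i)\<^sup>2) = 1" using v K by simp
  also have "(\<integral>\<^sup>+x. \<integral>\<^sup>+t. cone_ind c (sqrt 1 * t) (t\<^sup>2 + (\<Sum>i\<in>K. (x i)\<^sup>2))
            \<partial>lborel \<partial>(Pi\<^sub>M K (\<lambda>_. lborel)))
      = ennreal (unit_ball_vol (Suc (card K)) * cone_prob c (card K))"
    using nn_integral_cone_ind[OF K(1) c] unit_ball_vol_pos[of "real (Suc (card K))"]
    by (simp add: cone_prob_def del: unit_ball_vol_pos)
  finally show ?thesis .
qed

text \<open>Removing the origin costs nothing, because a point has volume zero in positive
  dimension; \<open>K \<noteq> {}\<close> provides that.\<close>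

lemma nn_integral_punctured_ball:
  assumes K: "finite K" "K \<noteq> {}"
  shows "(\<integral>\<^sup>+w. (if 0 < (\<Sum>i\<in>K. (w i)\<^sup>2) \<and> (\<Sum>i\<in>K. (w i)\<^sup>2) \<le> 1 then 1 else 0)
            \<partial>(Pi\<^sub>M K (\<lambda>_. lborel :: real measure)))
    = ennreal (unit_ball_vol (card K))"
proof -
  interpret product_sigma_finite "\<lambda>_::'a. lborel :: real measure" by standard
  let ?M = "Pi\<^sub>M K (\<lambda>_. lborel :: real measure)"
  let ?B = "{f. sqrt (\<Sum>i\<in>K. (f i)\<^sup>2) \<le> 1} \<inter> space ?M"
  have B: "?B \<in> sets ?M"
  proof -
    have "{x \<in> space ?M. sqrt (\<Sum>i\<in>K. (x i)\<^sup>2) \<le> 1} \<in> sets ?M" by measurable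
    then show ?thesis by (simp add: Int_def conj_commute)
  qed
  have "emeasure ?M (PiE K (\<lambda>_. {0})) = (\<Prod>i\<in>K. emeasure lborel {0::real})"
    using K by (intro emeasure_PiM) auto
  also have "\<dots> = 0" using K by (simp add: card_gt_0_iff)
  finally have "PiE K (\<lambda>_. {0}) \<in> null_sets ?M"
    using sets_PiM_I_finite[OF K(1), of "\<lambda>_. {0}" "\<lambda>_. lborel :: real measure"]
    by (intro null_setsI) auto
  moreover have "x \<in> PiE K (\<lambda>_. {0})"
    if "x \<in> space ?M" "\<not> 0 < (\<Sum>i\<in>K. (x i)\<^sup>2)" for x
  proof -
    have "(\<Sum>i\<in>K. (x i)\<^sup>2) = 0"
      using that(2) sum_nonneg[of K "\<lambda>i. (x i)\<^sup>2"] by force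
    then have "\<forall>i\<in>K. (x i)\<^sup>2 = 0" using K by (subst (asm) sum_nonneg_eq_0_iff) auto
    then show ?thesis using that(1) by (intro PiE_I) (auto simp: space_PiM)
  qed
  ultimately have "AE x in ?M. 0 < (\<Sum>i\<in>K. (x i)\<^sup>2)"
    by (intro AE_I'[of "PiE K (\<lambda>_. {0})"]) auto
  then have "AE x in ?M. (if 0 < (\<Sum>i\<in>K. (x i)\<^sup>2) \<and> (\<Sum>i\<in>K. (x i)\<^sup>2) \<le> 1 then 1 else 0)
      = (indicator ?B x :: ennreal)"
    by (rule AE_mp) (auto intro!: AE_I2 simp: indicator_def real_sqrt_le_iff')
  then have "(\<integral>\<^sup>+w. (if 0 < (\<Sum>i\<in>K. (w i)\<^sup>2) \<and> (\<Sum>i\<in>K. (w i)\<^sup>2) \<le> 1 then 1 else 0) \<partial>?M)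
      = (\<integral>\<^sup>+w. indicator ?B w \<partial>?M)"
    by (rule nn_integral_cong_AE)
  also have "\<dots> = emeasure ?M ?B" using B by simp
  finally show ?thesis using emeasure_cball_aux[OF K(1), of 1] by simp
qed

section \<open>Spherical distributions\<close>

definition dot :: "nat \<Rightarrow> (nat \<Rightarrow> real) \<Rightarrow> (nat \<Rightarrow> real) \<Rightarrow> real" where
  "dot n x y = (\<Sum>i=1..n. x i * y i)"

lemma dot_commute: "dot n x y = dot n y x"
  by (simp add: dot_def mult.commute)

lemma dot_nonneg: "0 \<le> dot n x x"
  by (auto simp: dot_def intro!: sum_nonneg)

lemma dot_eq_0_iff: "dot n x x = 0 \<longleftrightarrow> (\<forall>i\<in>{1..n}. x i = 0)"
  unfolding dot_def by (subst sum_nonneg_eq_0_iff) auto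

lemma dot_cong:
  "(\<And>i. i \<in> {1..n} \<Longrightarrow> x i = x' i) \<Longrightarrow> (\<And>i. i \<in> {1..n} \<Longrightarrow> y i = y' i) \<Longrightarrow> dot n x y = dot n x' y'"
  by (auto simp: dot_def intro!: sum.cong)

lemma dot_linear:
  "dot n (\<lambda>i. x i - a * y i) z = dot n x z - a * dot n y z"
  "dot n z (\<lambda>i. x i - a * y i) = dot n z x - a * dot n z y"
  by (simp_all add: dot_def algebra_simps sum_subtractf sum_distrib_left)

lemma measurable_dot [measurable]: "(\<lambda>x. dot n u x) \<in> borel_measurable (euclid n)"
  "(\<lambda>x. dot n x x) \<in> borel_measurable (euclid n)"
  unfolding dot_def by measurable

text \<open>For \<open>w = 0\<close> division by zero makes this the identity.\<close>

definition reflect :: "nat \<Rightarrow> (nat \<Rightarrow> real) \<Rightarrow> (nat \<Rightarrow> real) \<Rightarrow> nat \<Rightarrow> real" where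
  "reflect n w x = (\<lambda>i. x i - 2 / dot n w w * dot n w x * w i)"

definition reflect_mat :: "nat \<Rightarrow> (nat \<Rightarrow> real) \<Rightarrow> nat \<Rightarrow> nat \<Rightarrow> real" where
  "reflect_mat n w i j = (if i = j then 1 else 0) - 2 / dot n w w * w i * w j"

text \<open>With \<open>s = 2 / dot n w w\<close> the matrix is the identity minus \<open>s\<close>
  times the outer product of \<open>w\<close> with itself. Its Gram matrix differs from the identity
  by the factor \<open>s * s * dot n w w - 2 * s\<close>, which vanishes, also for
  \<open>w = 0\<close>, where \<open>s = 0\<close>.\<close>

lemma orthogonal_reflect_mat: "orthogonal_mat_n n (reflect_mat n w)"
  unfolding orthogonal_mat_n_def
proof (intro ballI)
  fix j k assume jk: "j \<in> {1..n}" "k \<in> {1..n}"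
  define s where "s = 2 / dot n w w"
  have s: "s * s * dot n w w = 2 * s" by (simp add: s_def)
  have "(\<Sum>i=1..n. reflect_mat n w i j * reflect_mat n w i k)
      = (\<Sum>i=1..n. (if i = j then (if j = k then 1 else 0) else 0)
           - (if i = j then s * w j * w k else 0) - (if i = k then s * w j * w k else 0)
           + s * s * w j * w k * (w i * w i))"
    unfolding reflect_mat_def s_def[symmetric] by (intro sum.cong refl) (auto simp: algebra_simps)
  also have "\<dots> = (if j = k then 1 else 0) - s * w j * w k - s * w j * w k
      + s * s * w j * w k * dot n w w"
    using jk by (simp add: sum.distrib sum_subtractf sum_distrib_left[symmetric] dot_def)
  also have "\<dots> = (if j = k then 1 else 0) + (s * s * dot n w w - 2 * s) * (w j * w k)"
    by (simp add: algebra_simps)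
  finally show "(\<Sum>i=1..n. reflect_mat n w i j * reflect_mat n w i k) = (if j = k then 1 else 0)"
    by (simp add: s)
qed

lemma mat_apply_reflect_mat:
  assumes "i \<in> {1..n}"
  shows "mat_apply n (reflect_mat n w) x i = reflect n w x i"
proof -
  have "(\<Sum>j=1..n. reflect_mat n w i j * x j)
      = (\<Sum>j=1..n. (if j = i then x i else 0) - 2 / dot n w w * w i * (w j * x j))"
    unfolding reflect_mat_def by (intro sum.cong refl) (auto simp: algebra_simps)
  also have "\<dots> = x i - 2 / dot n w w * w i * dot n w x"
    using assms by (simp add: sum_subtractf sum_distrib_left dot_def)
  finally show ?thesis using assms by (simp add: mat_apply_def reflect_def)
qed

lemma dot_reflect: "dot n x (reflect n w y) = dot n (reflect n w x) y"
  unfolding reflect_def dot_linear by (simp add: dot_commute)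

lemma dot_reflect_reflect: "dot n (reflect n w x) (reflect n w y) = dot n x y"
proof -
  define s where "s = 2 / dot n w w"
  have s: "s * s * dot n w w = 2 * s" by (simp add: s_def)
  have "dot n (reflect n w x) (reflect n w y)
      = dot n x y + (s * s * dot n w w - 2 * s) * (dot n w x * dot n w y)"
    unfolding reflect_def dot_linear s_def[symmetric] dot_commute[of n x w]
    by (simp add: algebra_simps dot_commute)
  then show ?thesis by (simp add: s)
qed

text \<open>For vectors of equal length, \<open>dot n w w = 2 * dot n w x\<close> with
  \<open>w\<close> their difference, so the reflection subtracts exactly \<open>w\<close> from
  \<open>x\<close>. The factor 1 in \<open>w\<close> fits the pattern of
  \<open>dot_linear\<close>.\<close>

lemma reflect_swap:
  assumes "dot n x x = dot n y y" "i \<in> {1..n}"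
  defines "w \<equiv> \<lambda>i. x i - 1 * y i"
  shows "reflect n w x i = y i"
proof (cases "dot n w w = 0")
  case True
  then show ?thesis using assms(2) by (auto simp: dot_eq_0_iff reflect_def w_def)
next
  case False
  have "dot n w w = 2 * dot n w x"
    unfolding w_def dot_linear using assms(1) by (simp add: dot_commute)
  then show ?thesis using False by (simp add: reflect_def w_def)
qed

lemma measurable_mat_apply: "mat_apply n Q \<in> measurable (euclid n) (euclid n)"
  unfolding mat_apply_def by (rule measurable_restrict) measurable

text \<open>A reflection preserves the law and the norm and is self-adjoint, so applying it to
  \<open>x\<close> amounts to applying it to \<open>u\<close> and \<open>v\<close>. Through this
  lemma, sphericity is used for reflections only.\<close>

lemma spherical_reflect:
  assumes sph: "spherical n P" and P: "sets P = sets (euclid n)"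
    and \<phi>: "\<And>u v. {x \<in> space (euclid n). \<phi> (dot n x x) (dot n u x) (dot n v x)} \<in> sets (euclid n)"
  shows "emeasure P {x \<in> space (euclid n). \<phi> (dot n x x) (dot n u x) (dot n v x)}
    = emeasure P {x \<in> space (euclid n). \<phi> (dot n x x) (dot n (reflect n w u) x) (dot n (reflect n w v) x)}"
proof -
  let ?Q = "mat_apply n (reflect_mat n w)"
  let ?A = "{x \<in> space (euclid n). \<phi> (dot n x x) (dot n u x) (dot n v x)}"
  have sp: "space P = space (euclid n)" using P by (rule sets_eq_imp_space_eq)
  have Q: "?Q \<in> measurable P (euclid n)"
    using measurable_mat_apply P by (simp cong: measurable_cong_sets)
  have "emeasure P ?A = emeasure (distr P (euclid n) ?Q) ?A"
    using sph orthogonal_reflect_mat by (simp add: spherical_def)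
  also have "\<dots> = emeasure P (?Q -` ?A \<inter> space P)"
    using Q \<phi> by (rule emeasure_distr)
  also have "?Q -` ?A \<inter> space P
      = {x \<in> space (euclid n). \<phi> (dot n x x) (dot n (reflect n w u) x) (dot n (reflect n w v) x)}"
  proof -
    have "?Q x \<in> space (euclid n)" if "x \<in> space (euclid n)" for x
      using measurable_mat_apply that by (rule measurable_space)
    moreover have "dot n (?Q x) (?Q x) = dot n x x" for x
      by (subst dot_reflect_reflect[of n w, symmetric]) (intro dot_cong mat_apply_reflect_mat)
    moreover have "dot n z (?Q x) = dot n (reflect n w z) x" for x z
      by (subst dot_reflect[symmetric]) (intro dot_cong mat_apply_reflect_mat refl)
    ultimately show ?thesis by (auto simp: sp)
  qed
  finally show ?thesis .
qed

lemma spherical_unit_invariant: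
  assumes sph: "spherical n P" and P: "sets P = sets (euclid n)"
    and \<phi>: "\<And>u. {x \<in> space (euclid n). \<phi> (dot n x x) (dot n u x)} \<in> sets (euclid n)"
    and "dot n u u = 1" "dot n v v = 1"
  shows "emeasure P {x \<in> space (euclid n). \<phi> (dot n x x) (dot n u x)}
    = emeasure P {x \<in> space (euclid n). \<phi> (dot n x x) (dot n v x)}"
proof -
  define w where "w = (\<lambda>i. u i - 1 * v i)"
  have "dot n (reflect n w u) x = dot n v x" for x
    unfolding w_def by (rule dot_cong[OF _ refl], rule reflect_swap) (use assms in auto)
  then show ?thesis
    using spherical_reflect[OF sph P, of "\<lambda>a b c. \<phi> a b" u u w] \<phi> by simp
qed

text \<open>Two reflections suffice. The first takes \<open>d\<close> to \<open>d'\<close> and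
  \<open>u\<close> to some \<open>u1\<close> orthogonal to \<open>d'\<close>; the second takes
  \<open>u1\<close> to \<open>u'\<close> and fixes \<open>d'\<close>, because its normal
  \<open>u1 - u'\<close> is orthogonal to \<open>d'\<close>.\<close>

lemma spherical_orthonormal_invariant:
  assumes sph: "spherical n P" and P: "sets P = sets (euclid n)"
    and \<phi>: "\<And>u v. {x \<in> space (euclid n). \<phi> (dot n x x) (dot n u x) (dot n v x)} \<in> sets (euclid n)"
    and on: "dot n u u = 1" "dot n d d = 1" "dot n u d = 0"
      "dot n u' u' = 1" "dot n d' d' = 1" "dot n u' d' = 0"
  shows "emeasure P {x \<in> space (euclid n). \<phi> (dot n x x) (dot n u x) (dot n d x)}
    = emeasure P {x \<in> space (euclid n). \<phi> (dot n x x) (dot n u' x) (dot n d' x)}"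
proof -
  define w where "w = (\<lambda>i. d i - 1 * d' i)"
  define u1 where "u1 = reflect n w u"
  have d: "dot n (reflect n w d) x = dot n d' x" for x
    unfolding w_def by (rule dot_cong[OF _ refl], rule reflect_swap) (use on in auto)
  have u1: "dot n u1 u1 = 1" "dot n u1 d' = 0"
    using on d[of u1] by (simp_all add: u1_def dot_reflect_reflect dot_commute[of n "reflect n w u" d'])
      (metis dot_commute dot_reflect_reflect)
  define w' where "w' = (\<lambda>i. u1 i - 1 * u' i)"
  have u': "dot n (reflect n w' u1) x = dot n u' x" for x
    unfolding w'_def by (rule dot_cong[OF _ refl], rule reflect_swap) (use on u1 in auto)
  have "dot n w' d' = 0" unfolding w'_def dot_linear using u1 on by simp
  then have d': "reflect n w' d' = d'" by (simp add: reflect_def)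
  show ?thesis
    using spherical_reflect[where \<phi> = \<phi>, OF sph P \<phi>, of u d w]
      spherical_reflect[where \<phi> = \<phi>, OF sph P \<phi>, of u1 d' w']
    by (simp add: d u1_def[symmetric] u' d')
qed

lemma dot_axis_combination:
  assumes "n \<ge> 2"
  shows "dot n (\<lambda>i. if i = 1 then a else if i = n then b else 0) x = a * x 1 + b * x n"
proof -
  have "dot n (\<lambda>i. if i = 1 then a else if i = n then b else 0) x
      = (\<Sum>i=1..n. (if i = 1 then a * x 1 else 0) + (if i = n then b * x n else 0))"
    unfolding dot_def using assms by (intro sum.cong) auto
  also have "\<dots> = a * x 1 + b * x n" using assms by (subst sum.distrib) simp
  finally show ?thesis .
qed

text \<open>The lines through countably many directions have equal mass and meet only in the origin.\<close>

lemma spherical_line_null: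
  assumes sph: "spherical n P" and P: "sets P = sets (euclid n)" and "prob_space P"
    and n: "n \<ge> 2"
    and zero: "measure P {x \<in> space (euclid n). dot n x x = 0} = 0"
    and d: "dot n d d = 1"
  shows "measure P {x \<in> space (euclid n). dot n x x \<le> (dot n d x)\<^sup>2} = 0"
proof -
  interpret prob_space P by fact
  define B where "B = (\<lambda>d. {x \<in> space (euclid n). 0 < dot n x x \<and> dot n x x \<le> (dot n d x)\<^sup>2})"
  \<comment> \<open>Unit vectors in the plane of the first and last axes, chosen so that the points
    on the line through \<open>e k\<close> satisfy \<open>x 1 = k * x n\<close>; different slopes
    make the lines disjoint away from the origin.\<close>
  define e where "e = (\<lambda>k::nat. (\<lambda>i. if i = 1 then real k / sqrt (1 + (real k)\<^sup>2)
      else if i = n then 1 / sqrt (1 + (real k)\<^sup>2) else 0))"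
  have B_sets: "B v \<in> sets P" for v unfolding B_def P
    by (intro sets.sets_Collect_conj; measurable)
  have e1: "dot n (e k) (e k) = 1" for k
  proof -
    have p: "0 < 1 + (real k)\<^sup>2" by (simp add: add_pos_nonneg)
    have "dot n (e k) (e k) = (real k / sqrt (1 + (real k)\<^sup>2)) * (real k / sqrt (1 + (real k)\<^sup>2))
        + (1 / sqrt (1 + (real k)\<^sup>2)) * (1 / sqrt (1 + (real k)\<^sup>2))"
      unfolding e_def using n by (subst dot_axis_combination) auto
    also have "\<dots> = ((real k)\<^sup>2 + 1) / (sqrt (1 + (real k)\<^sup>2))\<^sup>2"
      by (simp only: times_divide_times_eq add_divide_distrib power2_eq_square mult_1)
    also have "\<dots> = ((real k)\<^sup>2 + 1) / (1 + (real k)\<^sup>2)"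
      using p by simp
    finally show ?thesis using p by simp
  qed
  have eq: "measure P (B u) = measure P (B v)" if "dot n u u = 1" "dot n v v = 1" for u v
  proof -
    have "emeasure P (B u) = emeasure P (B v)"
      unfolding B_def
      by (rule spherical_unit_invariant[OF sph P, where \<phi> = "\<lambda>a b. 0 < a \<and> a \<le> b\<^sup>2"])
         (use B_sets that P in \<open>auto simp: B_def\<close>)
    then show ?thesis by (simp add: measure_def)
  qed
  have on_line: "x i = dot n v x * v i"
    if "dot n v v = 1" "x \<in> B v" "i \<in> {1..n}" for v x i
  proof -
    \<comment> \<open>This is the equality case of Cauchy-Schwarz: the residual of the projection
      onto \<open>v\<close> has squared norm \<open>dot n x x - (dot n v x)\<^sup>2\<close>, which
      is not positive on \<open>B v\<close>.\<close>
    define r where "r = (\<lambda>i. x i - dot n v x * v i)"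
    have "dot n r r = dot n x x - (dot n v x)\<^sup>2"
      unfolding r_def dot_linear using that(1)
      by (simp add: dot_commute[of n x v] power2_eq_square)
    also have "\<dots> \<le> 0" using that(2) by (simp add: B_def)
    finally have "dot n r r = 0" using dot_nonneg[of n r] by simp
    then show ?thesis using that(3) by (auto simp: dot_eq_0_iff r_def)
  qed
  have slope: "x 1 = real k * x n \<and> x n \<noteq> 0" if x: "x \<in> B (e k)" for k x
  proof -
    have xi: "x i = dot n (e k) x * e k i" if "i \<in> {1..n}" for i
      using on_line[OF e1 x that] .
    have "sqrt (1 + (real k)\<^sup>2) > 0" by (simp add: add_pos_nonneg)
    moreover have "dot n (e k) x \<noteq> 0"
      using x dot_nonneg[of n x] by (auto simp: B_def)
    ultimately show ?thesis using xi[of 1] xi[of n] n by (simp add: e_def)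
  qed
  have "disjoint_family (\<lambda>k. B (e k))"
    unfolding disjoint_family_on_def
  proof (intro ballI impI equals0I)
    fix k l :: nat and x assume "k \<noteq> l" "x \<in> B (e k) \<inter> B (e l)"
    then have "real k * x n = real l * x n" "x n \<noteq> 0" using slope[of x k] slope[of x l] by auto
    then show False using \<open>k \<noteq> l\<close> by simp
  qed
  \<comment> \<open>All terms of this convergent series are equal, hence zero.\<close>
  then have "(\<lambda>k. measure P (B (e k))) sums measure P (\<Union>k. B (e k))"
    using B_sets by (intro finite_measure_UNION) auto
  then have "(\<lambda>k. measure P (B (e k))) \<longlonglongrightarrow> 0"
    by (intro summable_LIMSEQ_zero sums_summable)
  then have "(\<lambda>k::nat. measure P (B d)) \<longlonglongrightarrow> 0"
    using eq[OF e1 d] by simp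
  then have Bd: "measure P (B d) = 0" by (simp add: LIMSEQ_const_iff)
  let ?Z = "{x \<in> space (euclid n). dot n x x = 0}"
  have Z: "?Z \<in> sets P" unfolding P by measurable
  have "measure P {x \<in> space (euclid n). dot n x x \<le> (dot n d x)\<^sup>2} \<le> measure P (B d \<union> ?Z)"
    using B_sets Z dot_nonneg
    by (intro finite_measure_mono sets.Un) (auto simp: B_def order_le_less)
  also have "\<dots> \<le> measure P (B d) + measure P ?Z"
    using B_sets Z by (rule measure_Un_le)
  finally show ?thesis using Bd zero by (simp add: measure_le_0_iff)
qed

text \<open>For a unit vector \<open>d\<close>, \<open>dot n x x - (dot n d x)\<^sup>2\<close> is
  the squared length of the projection of \<open>x\<close> orthogonal to \<open>d\<close>. The
  strict inequality excludes the multiples of \<open>d\<close>, for which the angle with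
  \<open>u\<close> after projection is undefined.\<close>

definition cap_event :: "nat \<Rightarrow> real \<Rightarrow> (nat \<Rightarrow> real) \<Rightarrow> (nat \<Rightarrow> real) \<Rightarrow> (nat \<Rightarrow> real) set" where
  "cap_event n c u d = {x \<in> space (euclid n).
     (dot n d x)\<^sup>2 < dot n x x \<and> c * sqrt (dot n x x - (dot n d x)\<^sup>2) \<le> dot n u x}"

text \<open>Move \<open>d\<close> to the last axis, average over \<open>u\<close> in the unit ball of the first \<open>n - 1\<close>
  coordinates, and exchange the integrals: the inner integral is then a cone volume that no longer
  depends on \<open>x\<close>.\<close>

lemma spherical_cap_event:
  assumes sph: "spherical n P" and P: "sets P = sets (euclid n)" and "prob_space P"
    and n: "n > 2" and c: "0 < c" "c < 1"
    and zero: "measure P {x \<in> space (euclid n). dot n x x = 0} = 0"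
    and on: "dot n u u = 1" "dot n d d = 1" "dot n u d = 0"
  shows "emeasure P (cap_event n c u d) = ennreal (cone_prob c (n - 2))"
proof -
  interpret prob_space P by fact
  interpret product_sigma_finite "\<lambda>_::nat. lborel :: real measure" by standard
  let ?K = "{1..<n}"
  let ?M = "Pi\<^sub>M ?K (\<lambda>_. lborel :: real measure)"
  interpret M: sigma_finite_measure ?M by (rule sigma_finite) simp
  interpret PM: pair_sigma_finite P ?M ..
  \<comment> \<open>The averaging ball has dimension \<open>n - 1\<close>; splitting off coordinate
    1 as axis leaves \<open>n - 2\<close> coordinates, the index in
    \<open>cone_prob\<close>.\<close>
  have K: "?K = insert 1 {2..<n}" "{1..n} = insert n ?K" "n \<notin> ?K" using n by auto
  have sp: "space P = space (euclid n)" using P by (rule sets_eq_imp_space_eq)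
  have [measurable_cong]: "sets P = sets (euclid n)" by (rule P)
  define q where "q = (\<lambda>w::nat \<Rightarrow> real. \<Sum>i\<in>?K. (w i)\<^sup>2)"
  define ip where "ip = (\<lambda>w x::nat \<Rightarrow> real. \<Sum>i\<in>?K. w i * x i)"
  \<comment> \<open>\<open>ax\<close> is the last coordinate axis, and \<open>dir w\<close> is
    \<open>w\<close> normalised and embedded in the hyperplane orthogonal to it; for
    \<open>0 < q w\<close> they form an orthonormal pair.\<close>
  define ax where "ax = (\<lambda>i. if i = n then 1 else 0 :: real)"
  define dir where "dir = (\<lambda>(w::nat \<Rightarrow> real) i. if i = n then 0 else w i / sqrt (q w))"
  have q0: "0 \<le> q w" for w unfolding q_def by (intro sum_nonneg) auto
  have dot_split: "dot n x y = x n * y n + ip x y" for x y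
    unfolding dot_def ip_def K(2) using K(3) by simp
  have ip_ax: "ip ax x = 0" for x unfolding ip_def ax_def by (intro sum.neutral) auto
  have ip_dir: "ip (dir w) x = ip w x / sqrt (q w)" for w x
    unfolding ip_def dir_def by (auto simp: sum_divide_distrib intro!: sum.cong)
  have ip_self: "ip w w = q w" for w by (simp add: ip_def q_def power2_eq_square)
  have ip_comm: "ip w x = ip x w" for w x by (simp add: ip_def mult.commute)
  have dax: "dot n ax x = x n" for x by (simp add: dot_split ip_ax) (simp add: ax_def)
  have ddir: "dot n (dir w) x = ip w x / sqrt (q w)" for w x
    by (simp add: dot_split ip_dir) (simp add: dir_def)
  have dxx: "dot n x x - (dot n ax x)\<^sup>2 = q x" for x
    unfolding dax by (simp add: dot_split ip_self power2_eq_square)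
  define F where "F = emeasure P (cap_event n c u d)"
  \<comment> \<open>Every \<open>w\<close> gives the same probability \<open>F\<close>, which is
    what allows averaging over \<open>w\<close>.\<close>
  have F: "emeasure P {x \<in> space P. 0 < q x \<and> c * sqrt (q x) * sqrt (q w) \<le> ip w x} = F"
    if w: "0 < q w" for w
  proof -
    have "dot n (dir w) (dir w) = 1"
      using w by (simp add: ddir ip_comm[of w "dir w"] ip_dir ip_self)
    moreover have "dot n ax ax = 1" by (simp add: dax) (simp add: ax_def)
    moreover have "dot n (dir w) ax = 0" by (simp add: ddir ip_comm[of w ax] ip_ax)
    ultimately have "F = emeasure P (cap_event n c (dir w) ax)"
      unfolding F_def cap_event_def
      by (intro spherical_orthonormal_invariant[OF sph P, where
            \<phi> = "\<lambda>a b e. e\<^sup>2 < a \<and> c * sqrt (a - e\<^sup>2) \<le> b"] on sets.sets_Collect_conj; measurable)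
    also have "cap_event n c (dir w) ax
        = {x \<in> space P. 0 < q x \<and> c * sqrt (q x) * sqrt (q w) \<le> ip w x}"
    proof -
      have "(dot n ax x)\<^sup>2 < dot n x x \<longleftrightarrow> 0 < q x" for x using dxx[of x] by linarith
      then show ?thesis unfolding cap_event_def dxx
        using w by (simp add: ddir sp pos_le_divide_eq)
    qed
    finally show ?thesis by simp
  qed
  have [measurable]: "q \<in> borel_measurable P"
  proof -
    have "(\<lambda>x. dot n x x - (dot n ax x)\<^sup>2) \<in> borel_measurable P" by measurable
    then show ?thesis by (simp only: dxx)
  qed
  have [measurable]: "q \<in> borel_measurable ?M" unfolding q_def by measurable
  have [measurable]: "(\<lambda>(x, w). ip w x) \<in> borel_measurable (P \<Otimes>\<^sub>M ?M)"
    unfolding ip_def case_prod_beta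
  proof (intro borel_measurable_sum borel_measurable_times)
    fix i assume "i \<in> ?K"
    then have i: "i \<in> {1..n}" by auto
    have "(\<lambda>x. x i) \<in> borel_measurable P"
      using measurable_component_singleton[OF i, of "\<lambda>_. borel :: real measure"] by measurable
    then show "(\<lambda>z. fst z i) \<in> borel_measurable (P \<Otimes>\<^sub>M ?M)"
      by (rule measurable_compose[OF measurable_fst])
    have "(\<lambda>w. w i) \<in> borel_measurable ?M"
      using measurable_component_singleton[OF \<open>i \<in> ?K\<close>, of "\<lambda>_. lborel :: real measure"] by simp
    then show "(\<lambda>z. snd z i) \<in> borel_measurable (P \<Otimes>\<^sub>M ?M)"
      by (rule measurable_compose[OF measurable_snd])
  qed
  have [measurable]: "(\<lambda>x. ip w x) \<in> borel_measurable P" for w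
    unfolding ip_def
  proof (intro borel_measurable_sum borel_measurable_times borel_measurable_const)
    fix i assume "i \<in> ?K"
    then have i: "i \<in> {1..n}" by auto
    show "(\<lambda>x. x i) \<in> borel_measurable P"
      using measurable_component_singleton[OF i, of "\<lambda>_. borel :: real measure"] by measurable
  qed
  define V where "V = ennreal (unit_ball_vol (real (n - 1)) * cone_prob c (n - 2))"
  \<comment> \<open>One indicator, read in two ways: for fixed \<open>w\<close> it is the cap event
    in \<open>x\<close>, and for fixed \<open>x\<close> it is a cone in \<open>w\<close> with axis
    along \<open>x\<close>.\<close>
  define I where "I = (\<lambda>x w. if 0 < q w \<and> q w \<le> 1 \<and> 0 < q x \<and> c * sqrt (q x) * sqrt (q w) \<le> ip w x
      then 1 else 0 :: ennreal)"
  have [measurable]: "(\<lambda>(x, w). I x w) \<in> borel_measurable (P \<Otimes>\<^sub>M ?M)"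
    unfolding I_def by measurable
  have inner_P: "(\<integral>\<^sup>+x. I x w \<partial>P) = F * (if 0 < q w \<and> q w \<le> 1 then 1 else 0)" for w
  proof (cases "0 < q w \<and> q w \<le> 1")
    case True
    have "(\<integral>\<^sup>+x. I x w \<partial>P)
        = (\<integral>\<^sup>+x. indicator {x \<in> space P. 0 < q x \<and> c * sqrt (q x) * sqrt (q w) \<le> ip w x} x \<partial>P)"
      using True by (intro nn_integral_cong) (auto simp: I_def indicator_def)
    also have "\<dots> = emeasure P {x \<in> space P. 0 < q x \<and> c * sqrt (q x) * sqrt (q w) \<le> ip w x}"
      by (intro nn_integral_indicator sets.sets_Collect_conj; measurable)
    finally show ?thesis using F True by simp
  qed (auto simp: I_def)
  have inner_M: "(\<integral>\<^sup>+w. I x w \<partial>?M) = V" if x: "0 < q x" for x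
  proof -
    define v where "v = (\<lambda>i. x i / sqrt (q x))"
    have "(\<Sum>i\<in>?K. (v i)\<^sup>2) = 1"
    proof -
      have "(\<Sum>i\<in>?K. (v i)\<^sup>2) = (\<Sum>i\<in>?K. (x i)\<^sup>2 / q x)"
        using x by (simp add: v_def power_divide)
      also have "\<dots> = q x / q x" by (simp only: q_def sum_divide_distrib)
      finally show ?thesis using x by simp
    qed
    then have "(\<integral>\<^sup>+w. cone_ind c (\<Sum>i\<in>?K. v i * w i) (\<Sum>i\<in>?K. (w i)\<^sup>2) \<partial>?M) = V"
      using nn_integral_cone_ind_unit_direction[of "{2..<n}" 1 c v] n c
      unfolding K(1) V_def by (simp add: Suc_diff_Suc numeral_2_eq_2)
    moreover have "I x w = cone_ind c (\<Sum>i\<in>?K. v i * w i) (\<Sum>i\<in>?K. (w i)\<^sup>2)" for w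
    proof -
      have "(\<Sum>i\<in>?K. v i * w i) = ip w x / sqrt (q x)"
        by (simp add: ip_def v_def sum_divide_distrib mult.commute)
      moreover have "(\<Sum>i\<in>?K. (w i)\<^sup>2) = q w" by (simp add: q_def)
      ultimately show ?thesis unfolding I_def cone_ind_def
        using x by (simp add: pos_le_divide_eq mult_ac)
    qed
    ultimately show ?thesis by simp
  qed
  have ax1: "dot n ax ax = 1" by (simp add: dax) (simp add: ax_def)
  \<comment> \<open>For multiples of \<open>ax\<close> the cone in \<open>w\<close> has no axis;
    \<open>spherical_line_null\<close> shows that they carry no mass.\<close>
  have "measure P {x \<in> space (euclid n). dot n x x \<le> (dot n ax x)\<^sup>2} = 0"
    using spherical_line_null[OF sph P \<open>prob_space P\<close> _ zero ax1] n by simp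
  moreover have "{x \<in> space (euclid n). dot n x x \<le> (dot n ax x)\<^sup>2} = {x \<in> space P. \<not> 0 < q x}"
  proof -
    have "dot n x x \<le> (dot n ax x)\<^sup>2 \<longleftrightarrow> \<not> 0 < q x" for x using dxx[of x] by linarith
    then show ?thesis by (simp add: sp)
  qed
  ultimately have "AE x in P. 0 < q x"
    by (subst AE_iff_measurable[OF _ refl]) (auto simp: emeasure_eq_measure)
  then have "AE x in P. (\<integral>\<^sup>+w. I x w \<partial>?M) = V"
    by (rule AE_mp) (intro AE_I2 impI inner_M)
  then have "(\<integral>\<^sup>+x. \<integral>\<^sup>+w. I x w \<partial>?M \<partial>P) = (\<integral>\<^sup>+x. V \<partial>P)"
    by (rule nn_integral_cong_AE)
  also have "\<dots> = V" by (simp add: emeasure_space_1)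
  also have "(\<integral>\<^sup>+x. \<integral>\<^sup>+w. I x w \<partial>?M \<partial>P) = (\<integral>\<^sup>+w. \<integral>\<^sup>+x. I x w \<partial>P \<partial>?M)"
    by (rule PM.Fubini'[symmetric]) measurable
  also have "\<dots> = F * (\<integral>\<^sup>+w. (if 0 < q w \<and> q w \<le> 1 then 1 else 0) \<partial>?M)"
    unfolding inner_P by (rule nn_integral_cmult) measurable
  also have "(\<integral>\<^sup>+w. (if 0 < q w \<and> q w \<le> 1 then 1 else 0) \<partial>?M) = ennreal (unit_ball_vol (real (n - 1)))"
    unfolding q_def using n by (subst nn_integral_punctured_ball) auto
  \<comment> \<open>The two orders of integration give \<open>F\<close> times the volume of the ball
    and the volume of the cone; dividing by the former volume leaves
    \<open>cone_prob\<close>.\<close>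
  finally have FV: "F * ennreal (unit_ball_vol (real (n - 1))) = V" .
  have vol: "0 < unit_ball_vol (real (n - 1))" by simp
  have "F \<noteq> \<infinity>" by (simp add: F_def)
  then obtain r where r: "F = ennreal r" "0 \<le> r" by (cases F) auto
  have "ennreal (r * unit_ball_vol (real (n - 1))) = ennreal (unit_ball_vol (real (n - 1)) * cone_prob c (n - 2))"
    using FV vol r by (simp add: V_def ennreal_mult')
  moreover have "0 \<le> cone_prob c (n - 2)" using c by (intro cone_prob_nonneg) auto
  ultimately have "r * unit_ball_vol (real (n - 1)) = unit_ball_vol (real (n - 1)) * cone_prob c (n - 2)"
    using r vol by (subst (asm) ennreal_inj) auto
  then have "r = cone_prob c (n - 2)" using vol by (metis mult.commute mult_cancel_left less_irrefl)
  then show ?thesis using r by (simp add: F_def)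
qed

text \<open>Take for \<open>u\<close> the centred and normalised \<open>y\<close>, and for
  \<open>d\<close> the normalised all-ones vector. The entries of \<open>u\<close> sum to 0, so
  centring \<open>x\<close> does not change its inner product with \<open>u\<close>, while it
  subtracts \<open>(dot n d x)\<^sup>2\<close> from the squared norm.\<close>

lemma pearson_ge_iff:
  assumes y: "\<not> (\<exists>k. \<forall>i\<in>{1..n}. y i = k)" and c: "0 < c"
  obtains u d where "dot n u u = 1" "dot n d d = 1" "dot n u d = 0"
    "{x \<in> space (euclid n). c \<le> pearson n x y} = cap_event n c u d"
proof -
  have n: "real n > 0" using y by (cases n) auto
  define a where "a = (\<lambda>i. y i - emp_mean n y)"
  define A where "A = (\<Sum>i=1..n. (a i)\<^sup>2)"
  define u where "u = (\<lambda>i. a i / sqrt A)"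
  define d where "d = (\<lambda>i::nat. 1 / sqrt (real n))"
  have mean: "(\<Sum>i=1..n. x i - emp_mean n x) = 0" for x
    using n by (simp add: sum_subtractf emp_mean_def)
  have "A \<noteq> 0"
  proof
    assume "A = 0"
    then have "\<forall>i\<in>{1..n}. a i = 0" unfolding A_def by (subst (asm) sum_nonneg_eq_0_iff) auto
    then show False using y by (auto simp: a_def)
  qed
  then have A: "A > 0" unfolding A_def by (simp add: order_less_le sum_nonneg)
  have uu: "dot n u u = 1"
  proof -
    have "dot n u u = (\<Sum>i=1..n. (a i)\<^sup>2 / A)"
      unfolding dot_def u_def using A by (intro sum.cong) (auto simp: power2_eq_square)
    also have "\<dots> = A / A" by (simp only: A_def sum_divide_distrib)
    finally show ?thesis using A by simp
  qed
  have dd: "dot n d d = 1" using n by (simp add: dot_def d_def)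
  have ud: "dot n u d = 0"
    using mean[of y] by (simp add: dot_def u_def d_def a_def sum_divide_distrib[symmetric])
  have dx: "(dot n d x)\<^sup>2 = real n * (emp_mean n x)\<^sup>2" for x
    using n by (simp add: dot_def d_def emp_mean_def sum_divide_distrib[symmetric] power_divide
        power2_eq_square)
  have ss: "(\<Sum>i=1..n. (x i - emp_mean n x)\<^sup>2) = dot n x x - (dot n d x)\<^sup>2" for x
  proof -
    have "(\<Sum>i=1..n. (x i - emp_mean n x)\<^sup>2)
        = dot n x x - 2 * emp_mean n x * (\<Sum>i=1..n. x i) + real n * (emp_mean n x)\<^sup>2"
    proof -
      have "(\<Sum>i=1..n. (x i - emp_mean n x)\<^sup>2)
          = (\<Sum>i=1..n. x i * x i - 2 * emp_mean n x * x i + (emp_mean n x)\<^sup>2)"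
        by (intro sum.cong) (auto simp: power2_eq_square algebra_simps)
      then show ?thesis by (simp add: dot_def sum.distrib sum_subtractf sum_distrib_left)
    qed
    also have "(\<Sum>i=1..n. x i) = real n * emp_mean n x" using n by (simp add: emp_mean_def)
    finally show ?thesis by (simp only: dx) (simp add: power2_eq_square)
  qed
  have num: "(\<Sum>i=1..n. (x i - emp_mean n x) * (y i - emp_mean n y)) = sqrt A * dot n u x" for x
  proof -
    have "(\<Sum>i=1..n. (x i - emp_mean n x) * (y i - emp_mean n y))
        = (\<Sum>i=1..n. x i * a i) - emp_mean n x * (\<Sum>i=1..n. a i)"
      by (simp add: a_def sum_subtractf sum_distrib_left algebra_simps sum.distrib)
    also have "(\<Sum>i=1..n. a i) = 0" using mean[of y] by (simp add: a_def)
    finally show ?thesis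
      using A by (simp add: dot_def u_def sum_distrib_left mult.commute)
  qed
  have "c \<le> pearson n x y \<longleftrightarrow>
      (dot n d x)\<^sup>2 < dot n x x \<and> c * sqrt (dot n x x - (dot n d x)\<^sup>2) \<le> dot n u x" for x
  proof -
    define S where "S = dot n x x - (dot n d x)\<^sup>2"
    have S: "0 \<le> S" unfolding S_def ss[symmetric] by (intro sum_nonneg) auto
    have yA: "(\<Sum>i=1..n. (y i - emp_mean n y)\<^sup>2) = A" by (simp add: A_def a_def)
    have p: "pearson n x y = dot n u x / sqrt S"
      unfolding pearson_def num ss[of x] S_def[symmetric] yA
      using A by (simp add: real_sqrt_mult)
    have "(dot n d x)\<^sup>2 < dot n x x \<longleftrightarrow> 0 < S" by (simp add: S_def)
    \<comment> \<open>For constant \<open>x\<close> the quotient has the default value 0, which is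
      below \<open>c\<close>; this matches the strict inequality in
      \<open>cap_event\<close>.\<close>
    moreover have "c \<le> dot n u x / sqrt S \<longleftrightarrow> 0 < S \<and> c * sqrt S \<le> dot n u x"
      using S c by (cases "S = 0") (auto simp: pos_le_divide_eq)
    ultimately show ?thesis unfolding p S_def[symmetric] by simp
  qed
  then show thesis using that[OF uu dd ud] by (simp add: cap_event_def)
qed

section \<open>The correlation coefficient\<close>

lemma measurable_pearson [measurable]:
  "(\<lambda>z. pearson n (fst z) (snd z)) \<in> borel_measurable (euclid n \<Otimes>\<^sub>M euclid n)"
  unfolding pearson_def emp_mean_def by measurable

text \<open>By independence the joint law is a product, so the probability is an integral over
  \<open>y\<close> of section probabilities. Outside the null set of constant vectors each section
  is a cap event, and all of these have the same mass, whatever the law of \<open>Y\<close>.\<close>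

lemma prob_pearson_ge:
  assumes n: "n > 2" and c: "0 < c" "c < 1"
    and "prob_space M"
    and X [measurable]: "X \<in> measurable M (euclid n)"
    and Y [measurable]: "Y \<in> measurable M (euclid n)"
    and indep: "prob_space.indep_var M (euclid n) X (euclid n) Y"
    and sph: "spherical n (distr M (euclid n) X)"
    and X0: "measure M {\<omega> \<in> space M. \<forall>i\<in>{1..n}. X \<omega> i = 0} = 0"
    and Y0: "measure M {\<omega> \<in> space M. \<exists>k. \<forall>i\<in>{1..n}. Y \<omega> i = k} = 0"
  shows "measure M {\<omega> \<in> space M. c \<le> pearson n (X \<omega>) (Y \<omega>)} = cone_prob c (n - 2)"
proof -
  interpret prob_space M by fact
  let ?P = "distr M (euclid n) X" and ?R = "distr M (euclid n) Y"
  interpret P: prob_space ?P using X by (rule prob_space_distr)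
  interpret R: prob_space ?R using Y by (rule prob_space_distr)
  interpret PR: pair_sigma_finite ?P ?R ..
  define E where "E = {z \<in> space (euclid n \<Otimes>\<^sub>M euclid n). c \<le> pearson n (fst z) (snd z)}"
  have E: "E \<in> sets (euclid n \<Otimes>\<^sub>M euclid n)" unfolding E_def by measurable
  have "measure ?P {x \<in> space (euclid n). dot n x x = 0} = 0"
  proof -
    have "measure ?P {x \<in> space (euclid n). dot n x x = 0}
        = measure M (X -` {x \<in> space (euclid n). dot n x x = 0} \<inter> space M)"
      by (rule measure_distr) measurable
    also have "X -` {x \<in> space (euclid n). dot n x x = 0} \<inter> space M
        = {\<omega> \<in> space M. \<forall>i\<in>{1..n}. X \<omega> i = 0}"
      using measurable_space[OF X] by (auto simp: dot_eq_0_iff)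
    finally show ?thesis using X0 by simp
  qed
  then have slice: "emeasure ?P {x \<in> space (euclid n). c \<le> pearson n x y} = ennreal (cone_prob c (n - 2))"
    if y: "\<not> (\<exists>k. \<forall>i\<in>{1..n}. y i = k)" for y
  proof -
    obtain u d where "dot n u u = 1" "dot n d d = 1" "dot n u d = 0"
      "{x \<in> space (euclid n). c \<le> pearson n x y} = cap_event n c u d"
      by (rule pearson_ge_iff[OF y c(1)])
    then show ?thesis
      using spherical_cap_event[OF sph _ P.prob_space_axioms n c] \<open>measure ?P _ = 0\<close> by simp
  qed
  \<comment> \<open>Comparing with coordinate 1 replaces the existential over uncountably many
    \<open>k\<close> by a finite conjunction, which makes the set \<open>N\<close>
    measurable.\<close>
  have const: "(\<forall>i\<in>{1..n}. y i = y 1) \<longleftrightarrow> (\<exists>k. \<forall>i\<in>{1..n}. y i = k)" for y :: "nat \<Rightarrow> real"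
  proof
    show "\<exists>k. \<forall>i\<in>{1..n}. y i = k" if "\<forall>i\<in>{1..n}. y i = y 1" using that by (rule exI)
    show "\<forall>i\<in>{1..n}. y i = y 1" if ex: "\<exists>k. \<forall>i\<in>{1..n}. y i = k"
    proof -
      obtain k where k: "\<forall>i\<in>{1..n}. y i = k" using ex ..
      then have "y 1 = k" using n by simp
      then show ?thesis using k by simp
    qed
  qed
  define N where "N = {y \<in> space (euclid n). \<forall>i\<in>{1..n}. y i = y 1}"
  have N: "N \<in> sets (euclid n)"
  proof -
    have "1 \<in> {1..n}" using n by simp
    then show ?thesis unfolding N_def
      using measurable_component_singleton[of _ "{1..n}" "\<lambda>_. borel :: real measure"]
      by (intro sets.sets_Collect_finite_All borel_measurable_eq[unfolded pred_def]) auto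
  qed
  have "measure ?R N = measure M (Y -` N \<inter> space M)"
    using Y N by (rule measure_distr)
  also have "Y -` N \<inter> space M = {\<omega> \<in> space M. \<exists>k. \<forall>i\<in>{1..n}. Y \<omega> i = k}"
    unfolding N_def const using measurable_space[OF Y] by blast
  finally have "measure ?R N = 0" by (simp only: Y0)
  then have "emeasure ?R N = 0" by (simp only: R.emeasure_eq_measure ennreal_0)
  then have "N \<in> null_sets ?R" using N by (intro null_setsI) auto
  then have AE: "AE y in ?R. \<not> (\<exists>k. \<forall>i\<in>{1..n}. y i = k)"
    by (rule AE_I') (unfold N_def const space_distr, blast)
  have "emeasure M {\<omega> \<in> space M. c \<le> pearson n (X \<omega>) (Y \<omega>)}
      = emeasure (distr M (euclid n \<Otimes>\<^sub>M euclid n) (\<lambda>\<omega>. (X \<omega>, Y \<omega>))) E"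
  proof -
    have "(\<lambda>\<omega>. (X \<omega>, Y \<omega>)) \<in> measurable M (euclid n \<Otimes>\<^sub>M euclid n)" by measurable
    moreover have "(\<lambda>\<omega>. (X \<omega>, Y \<omega>)) -` E \<inter> space M
        = {\<omega> \<in> space M. c \<le> pearson n (X \<omega>) (Y \<omega>)}"
      using measurable_space[OF X] measurable_space[OF Y] by (auto simp: E_def space_pair_measure)
    ultimately show ?thesis using E by (simp only: emeasure_distr)
  qed
  also have "\<dots> = emeasure (?P \<Otimes>\<^sub>M ?R) E"
    using indep unfolding indep_var_distribution_eq by simp
  also have "\<dots> = (\<integral>\<^sup>+y. emeasure ?P ((\<lambda>x. (x, y)) -` E) \<partial>?R)"
    using E by (intro PR.emeasure_pair_measure_alt2) (simp cong: sets_pair_measure_cong)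
  also have "\<dots> = (\<integral>\<^sup>+y. ennreal (cone_prob c (n - 2)) \<partial>?R)"
  proof (rule nn_integral_cong_AE)
    have "emeasure ?P ((\<lambda>x. (x, y)) -` E) = ennreal (cone_prob c (n - 2))"
      if "y \<in> space ?R" "\<not> (\<exists>k. \<forall>i\<in>{1..n}. y i = k)" for y
    proof -
      have "(\<lambda>x. (x, y)) -` E = {x \<in> space (euclid n). c \<le> pearson n x y}"
        using that(1) by (auto simp: E_def space_pair_measure)
      then show ?thesis using slice[OF that(2)] by simp
    qed
    then show "AE y in ?R. emeasure ?P ((\<lambda>x. (x, y)) -` E) = ennreal (cone_prob c (n - 2))"
      by (intro AE_mp[OF AE AE_I2] impI)
  qed
  also have "\<dots> = ennreal (cone_prob c (n - 2))"
    by (simp only: nn_integral_const R.emeasure_space_1 mult_1_right)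
  finally show ?thesis
    using cone_prob_nonneg[of c "n - 2"] c by (simp add: measure_def)
qed

theorem theorem2p3:
  fixes c :: real
    and M :: "nat \<Rightarrow> 'a measure"
    and X Y :: "nat \<Rightarrow> 'a \<Rightarrow> nat \<Rightarrow> real"
  assumes c: "0 < c" "c < 1"
    and prob: "\<And>n. n > 2 \<Longrightarrow> prob_space (M n)"
    and X_meas: "\<And>n. n > 2 \<Longrightarrow> X n \<in> measurable (M n) (euclid n)"
    and Y_meas: "\<And>n. n > 2 \<Longrightarrow> Y n \<in> measurable (M n) (euclid n)"
    and indep: "\<And>n. n > 2 \<Longrightarrow> prob_space.indep_var (M n) (euclid n) (X n) (euclid n) (Y n)"
    and X_spherical: "\<And>n. n > 2 \<Longrightarrow> spherical n (distr (M n) (euclid n) (X n))"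
    and X_nonzero: "\<And>n. n > 2 \<Longrightarrow>
          measure (M n) {\<omega> \<in> space (M n). \<forall>i\<in>{1..n}. X n \<omega> i = 0} = 0"
    and Y_nonconst: "\<And>n. n > 2 \<Longrightarrow>
          measure (M n) {\<omega> \<in> space (M n). \<exists>k. \<forall>i\<in>{1..n}. Y n \<omega> i = k} = 0"
  shows "(\<exists>!l. (L_fun has_real_derivative c) (at l))
       \<and> lambda_c c = c / (1 - c\<^sup>2)
       \<and> (deriv L_fun has_real_derivative (sigma_c c)\<^sup>2) (at (lambda_c c))
       \<and> (sigma_c c)\<^sup>2 = (1 - c\<^sup>2)\<^sup>2 / (1 + c\<^sup>2)
       \<and> sigma_c c > 0
       \<and> (\<lambda>n. measure (M n) {\<omega> \<in> space (M n). pearson n (X n \<omega>) (Y n \<omega>) \<ge> c})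
         \<sim>[at_top]
         (\<lambda>n. exp (- real n * L_star c - 1/4 * ln (1 + 4 * (lambda_c c)\<^sup>2)
                    + 3/2 * ln ((1 + sqrt (1 + 4 * (lambda_c c)\<^sup>2)) / 2))
              / (lambda_c c * sigma_c c * sqrt (2 * pi * real n)))"
proof -
  have "\<forall>\<^sub>F n in at_top. cone_prob c (n - 2)
      = measure (M n) {\<omega> \<in> space (M n). pearson n (X n \<omega>) (Y n \<omega>) \<ge> c}"
    using eventually_gt_at_top[of 2]
  proof eventually_elim
    case (elim n)
    show ?case
      by (rule prob_pearson_ge[symmetric, OF elim c prob X_meas Y_meas indep X_spherical X_nonzero Y_nonconst];
          fact elim)
  qed
  moreover have "\<forall>\<^sub>F n in at_top. sqrt (1 - c\<^sup>2) ^ (n - 2) / (c * sqrt (2 * pi * real n))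
      = exp (- real n * L_star c - 1/4 * ln (1 + 4 * (lambda_c c)\<^sup>2)
                    + 3/2 * ln ((1 + sqrt (1 + 4 * (lambda_c c)\<^sup>2)) / 2))
              / (lambda_c c * sigma_c c * sqrt (2 * pi * real n))"
    using eventually_gt_at_top[of 2]
    by eventually_elim (rule saddlepoint_term_eq[OF c, symmetric])
  ultimately have "(\<lambda>n. measure (M n) {\<omega> \<in> space (M n). pearson n (X n \<omega>) (Y n \<omega>) \<ge> c})
         \<sim>[at_top]
         (\<lambda>n. exp (- real n * L_star c - 1/4 * ln (1 + 4 * (lambda_c c)\<^sup>2)
                    + 3/2 * ln ((1 + sqrt (1 + 4 * (lambda_c c)\<^sup>2)) / 2))
              / (lambda_c c * sigma_c c * sqrt (2 * pi * real n)))"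
    using cone_prob_asymp[OF c] by (rule asymp_equiv_cong[THEN iffD1])
  then show ?thesis
    using ex1_L_fun_deriv[OF c] lambda_c_eq[OF c] deriv_L_fun_has_derivative[OF c]
      sigma_c_squared[OF c] sigma_c_pos[OF c] by blast
qed

end
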